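(* Let $H$ be a hyperbolic group generated by a finite set $A$ and let $\varphi\in\mathrm{End}(H)$. The following conditions are equivalent: (i) The BRP holds for $\varphi$. (ii) The BRP holds for $\varphi$ when $p=0$. (iii) For every $p>0$ there is $q>0$ such that for all $u,v\in H$: $(u|v)\le p\Rightarrow (u\varphi|v\varphi)\le q$. (iv) There is $q>0$ such that for all $u,v\in H$: $(u|v)=0\Rightarrow (u\varphi|v\varphi)\le q$. (v) There is some $N\in\mathbb N$ such that, for all $x,y\in H$, every geodesic $\alpha=[x,y]$ and every geodesic $\xi=[x\varphi,y\varphi]$, the Hausdorff distance between $\alpha\varphi$ and $\xi$ is at most $N$. (vi) There is some $N\in\mathbb N$ such that, for all $x,y\in H$ and every geodesic $\alpha=[x,y]$, we have $\alpha\varphi\subseteq\mathcal V_N(\xi)$ for every geodesic $\xi=[x\varphi,y\varphi]$. (vii) $\varphi$ is coarse-median preserving.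
   Context: Maps are written on the right. $d=d_A$ is the word metric on $H$ with respect to $A$, $|g|=d(1,g)$, and $(u|v)=\frac12(|u|+|v|-d(u,v))$ is the Gromov product based at $1$. $H$ is hyperbolic means that its Cayley graph with respect to $A$ (edges of length 1) is $\delta$-hyperbolic for some $\delta\ge0$: each side of any geodesic triangle lies in the $\delta$-neighbourhood of the union of the other two sides. For $x,y\in H$, a geodesic $[x,y]$ is (regarded on vertices) a map $\xi:\{0,\dots,n\}\to H$ with $0\xi=x$, $n\xi=y$, $d(i\xi,j\xi)=|i-j|$ for all $i,j$; its image is denoted by the same symbol. A $(\lambda,K)$-quasi-geodesic is a map $\xi:\{0,\dots,n\}\to H$ with $\frac1\lambda|i-j|-K\le d(i\xi,j\xi)\le\lambda|i-j|+K$ for all $i,j$. For a geodesic $\alpha$, $\alpha\varphi=\{h\varphi : h\in H\text{ on }\alpha\}$. $\mathcal V_N(Y)=\{x : d(x,Y)\le N\}$. The concatenation of $\alpha$ from $x$ to $y$ and $\beta$ from $y$ to $z$ is denoted $\alpha+\beta$. BRP (bounded reduction property): the BRP holds for $\varphi:H\to H$ if for every $p\ge0$ there is $q\ge0$ such that the following holds: for all $u,v\in H$, if there are geodesics from $1$ to $u$ and from $u$ to $uv$ whose concatenation is a $(1,p)$-quasi-geodesic, then for any geodesics $\alpha$ from $1$ to $u\varphi$ and $\beta$ from $u\varphi$ to $(uv)\varphi$, the concatenation $\alpha+\beta$ is a $(1,q)$-quasi-geodesic. "The BRP holds for $\varphi$ when $p=0$" means that such a $q$ exists for $p=0$. Coarse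 median: since $H$ is hyperbolic there is $K\ge0$ such that for all $x,y,z\in H$ there is a point of $H$ at distance at most $K$ from each side of every geodesic triangle with vertices $x,y,z$ (a $K$-center); such a point is determined by $x,y,z$ up to bounded distance. Let $\mu:H^3\to H$ be the operator choosing such a $K$-center (symmetric in its arguments and with $\mu(a,a,b)=a$). $\varphi$ is coarse-median preserving if there is $C\ge0$ with $d(\mu(x,y,z)\varphi,\mu(x\varphi,y\varphi,z\varphi))\le C$ for all $x,y,z\in H$ (this does not depend on the choice of $K$ and $\mu$). *)

theory Defs
  imports Complex_Main "HOL-Algebra.Generated_Groups"
begin

section \<open>Metric notions on a carrier set\<close>

definition point_set_dist :: "('p \<Rightarrow> 'p \<Rightarrow> real) \<Rightarrow> 'p \<Rightarrow> 'p set \<Rightarrow> real" where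
  "point_set_dist d x Y = (INF y\<in>Y. d x y)"

definition nbhd :: "'p set \<Rightarrow> ('p \<Rightarrow> 'p \<Rightarrow> real) \<Rightarrow> real \<Rightarrow> 'p set \<Rightarrow> 'p set" where
  "nbhd M d r Y = {x \<in> M. point_set_dist d x Y \<le> r}"

definition hausdorff_distance :: "'p set \<Rightarrow> ('p \<Rightarrow> 'p \<Rightarrow> real) \<Rightarrow> 'p set \<Rightarrow> 'p set \<Rightarrow> real" where
  "hausdorff_distance M d X Y = Inf {r. 0 \<le> r \<and> X \<subseteq> nbhd M d r Y \<and> Y \<subseteq> nbhd M d r X}"

definition geodesic_segment ::
    "'p set \<Rightarrow> ('p \<Rightarrow> 'p \<Rightarrow> real) \<Rightarrow> 'p \<Rightarrow> 'p \<Rightarrow> 'p set \<Rightarrow> bool" where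
  "geodesic_segment M d x y S \<longleftrightarrow>
     (\<exists>(L::real) \<gamma>. 0 \<le> L \<and> \<gamma> 0 = x \<and> \<gamma> L = y \<and> \<gamma> ` {0..L} = S \<and> S \<subseteq> M \<and>
        (\<forall>s\<in>{0..L}. \<forall>t\<in>{0..L}. d (\<gamma> s) (\<gamma> t) = \<bar>s - t\<bar>))"

definition delta_hyperbolic :: "'p set \<Rightarrow> ('p \<Rightarrow> 'p \<Rightarrow> real) \<Rightarrow> real \<Rightarrow> bool" where
  "delta_hyperbolic M d \<delta> \<longleftrightarrow>
     (\<forall>x\<in>M. \<forall>y\<in>M. \<forall>z\<in>M. \<forall>S T U.
        geodesic_segment M d x y S \<and> geodesic_segment M d y z T \<and> geodesic_segment M d z x U \<longrightarrow>
        S \<subseteq> nbhd M d \<delta> (T \<union> U) \<and> T \<subseteq> nbhd M d \<delta> (S \<union> U) \<and> U \<subseteq> nbhd M d \<delta> (S \<union> T))"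

section \<open>Word metric and Cayley graph\<close>

definition word_dist :: "('a, 'b) monoid_scheme \<Rightarrow> 'a set \<Rightarrow> 'a \<Rightarrow> 'a \<Rightarrow> real" where
  "word_dist G A x y = real (LEAST n. \<exists>ws. length ws = n \<and> set ws \<subseteq> A \<union> m_inv G ` A \<and>
     foldr (mult G) ws (one G) = mult G (m_inv G x) y)"

definition word_norm :: "('a, 'b) monoid_scheme \<Rightarrow> 'a set \<Rightarrow> 'a \<Rightarrow> real" where
  "word_norm G A g = word_dist G A (one G) g"

definition gromov_product :: "('a, 'b) monoid_scheme \<Rightarrow> 'a set \<Rightarrow> 'a \<Rightarrow> 'a \<Rightarrow> real" where
  "gromov_product G A u v = (word_norm G A u + word_norm G A v - word_dist G A u v) / 2"

definition cayley_edge :: "('a, 'b) monoid_scheme \<Rightarrow> 'a set \<Rightarrow> 'a \<Rightarrow> 'a \<Rightarrow> bool" where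
  "cayley_edge G A g h \<longleftrightarrow> g \<in> carrier G \<and> h \<in> carrier G \<and> g \<noteq> h \<and>
     (\<exists>a\<in>A. h = mult G g a \<or> g = mult G h a)"

text \<open>The Cayley graph as a metric space, with all edges of length 1. Points are given by
  barycentric coordinates: a nonnegative function of total mass 1 supported on one vertex or on
  the two ends of an edge; the vertex \<open>g\<close> is the indicator function of \<open>{g}\<close>. The graph is taken
  to be simple (no loop for \<open>1 \<in> A\<close>, no double edge when \<open>a\<close> and its inverse both lie in \<open>A\<close>).\<close>

definition supp :: "('a \<Rightarrow> real) \<Rightarrow> 'a set" where
  "supp p = {x. p x \<noteq> 0}"

definition cayley_points :: "('a, 'b) monoid_scheme \<Rightarrow> 'a set \<Rightarrow> ('a \<Rightarrow> real) set" where
  "cayley_points G A = {p. (\<forall>x. 0 \<le> p x) \<and>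
     (\<exists>g\<in>carrier G. \<exists>h\<in>carrier G. (g = h \<or> cayley_edge G A g h) \<and>
        supp p \<subseteq> {g, h} \<and> (\<Sum>x\<in>{g, h}. p x) = 1)}"

text \<open>The path metric. Two points of a common edge \<open>{g, h}\<close> are at distance
  \<open>\<bar>p g - q g\<bar> = \<bar>p h - q h\<bar>\<close>, which is half of the sum below. Otherwise a shortest path leaves
  the edge of \<open>p\<close> at an end \<open>g\<close>, at distance \<open>1 - p g\<close> from \<open>p\<close>, and enters the edge of \<open>q\<close> at an
  end \<open>h\<close>, at distance \<open>1 - q h\<close> from \<open>q\<close>.\<close>

definition cayley_dist ::
    "('a, 'b) monoid_scheme \<Rightarrow> 'a set \<Rightarrow> ('a \<Rightarrow> real) \<Rightarrow> ('a \<Rightarrow> real) \<Rightarrow> real" where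
  "cayley_dist G A p q =
     (if \<exists>g\<in>carrier G. \<exists>h\<in>carrier G. (g = h \<or> cayley_edge G A g h) \<and> supp p \<union> supp q \<subseteq> {g, h}
      then (\<Sum>x\<in>supp p \<union> supp q. \<bar>p x - q x\<bar>) / 2
      else Min ((\<lambda>(g, h). (1 - p g) + word_dist G A g h + (1 - q h)) ` (supp p \<times> supp q)))"

definition hyperbolic_group :: "('a, 'b) monoid_scheme \<Rightarrow> 'a set \<Rightarrow> bool" where
  "hyperbolic_group G A \<longleftrightarrow>
     (\<exists>\<delta>\<ge>0. delta_hyperbolic (cayley_points G A) (cayley_dist G A) \<delta>)"

section \<open>Geodesics and quasi-geodesics on vertices\<close>

text \<open>A path \<open>\<xi> : {0,\<dots>,n} \<rightarrow> H\<close> is a function on \<open>nat\<close> together with \<open>n\<close>; values beyond \<open>n\<close> are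
  irrelevant, and its image is \<open>\<xi> ` {..n}\<close>.\<close>

definition geodesic ::
    "('a, 'b) monoid_scheme \<Rightarrow> 'a set \<Rightarrow> 'a \<Rightarrow> 'a \<Rightarrow> nat \<Rightarrow> (nat \<Rightarrow> 'a) \<Rightarrow> bool" where
  "geodesic G A x y n \<xi> \<longleftrightarrow> (\<forall>i\<le>n. \<xi> i \<in> carrier G) \<and> \<xi> 0 = x \<and> \<xi> n = y \<and>
     (\<forall>i\<le>n. \<forall>j\<le>n. word_dist G A (\<xi> i) (\<xi> j) = \<bar>real i - real j\<bar>)"

definition quasi_geodesic ::
    "('a, 'b) monoid_scheme \<Rightarrow> 'a set \<Rightarrow> real \<Rightarrow> real \<Rightarrow> nat \<Rightarrow> (nat \<Rightarrow> 'a) \<Rightarrow> bool" where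
  "quasi_geodesic G A l K n \<xi> \<longleftrightarrow> (\<forall>i\<le>n. \<xi> i \<in> carrier G) \<and>
     (\<forall>i\<le>n. \<forall>j\<le>n. 1 / l * \<bar>real i - real j\<bar> - K \<le> word_dist G A (\<xi> i) (\<xi> j) \<and>
        word_dist G A (\<xi> i) (\<xi> j) \<le> l * \<bar>real i - real j\<bar> + K)"

definition path_concat :: "nat \<Rightarrow> (nat \<Rightarrow> 'a) \<Rightarrow> (nat \<Rightarrow> 'a) \<Rightarrow> nat \<Rightarrow> 'a" where
  "path_concat m \<alpha> \<beta> k = (if k \<le> m then \<alpha> k else \<beta> (k - m))"

section \<open>Bounded reduction property\<close>

definition BRP_at :: "('a, 'b) monoid_scheme \<Rightarrow> 'a set \<Rightarrow> ('a \<Rightarrow> 'a) \<Rightarrow> real \<Rightarrow> bool" where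
  "BRP_at G A \<phi> p \<longleftrightarrow>
     (\<exists>q\<ge>0. \<forall>u\<in>carrier G. \<forall>v\<in>carrier G.
        (\<exists>m \<alpha> n \<beta>. geodesic G A (one G) u m \<alpha> \<and> geodesic G A u (mult G u v) n \<beta> \<and>
           quasi_geodesic G A 1 p (m + n) (path_concat m \<alpha> \<beta>)) \<longrightarrow>
        (\<forall>m \<alpha> n \<beta>. geodesic G A (one G) (\<phi> u) m \<alpha> \<and>
           geodesic G A (\<phi> u) (\<phi> (mult G u v)) n \<beta> \<longrightarrow>
           quasi_geodesic G A 1 q (m + n) (path_concat m \<alpha> \<beta>)))"

definition BRP :: "('a, 'b) monoid_scheme \<Rightarrow> 'a set \<Rightarrow> ('a \<Rightarrow> 'a) \<Rightarrow> bool" where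
  "BRP G A \<phi> \<longleftrightarrow> (\<forall>p\<ge>0. BRP_at G A \<phi> p)"

section \<open>Coarse medians\<close>

definition K_center ::
    "('a, 'b) monoid_scheme \<Rightarrow> 'a set \<Rightarrow> real \<Rightarrow> 'a \<Rightarrow> 'a \<Rightarrow> 'a \<Rightarrow> 'a \<Rightarrow> bool" where
  "K_center G A K x y z c \<longleftrightarrow> c \<in> carrier G \<and>
     (\<forall>l \<alpha> m \<beta> n \<gamma>. geodesic G A x y l \<alpha> \<and> geodesic G A y z m \<beta> \<and> geodesic G A z x n \<gamma> \<longrightarrow>
        point_set_dist (word_dist G A) c (\<alpha> ` {..l}) \<le> K \<and>
        point_set_dist (word_dist G A) c (\<beta> ` {..m}) \<le> K \<and>
        point_set_dist (word_dist G A) c (\<gamma> ` {..n}) \<le> K)"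

definition coarse_median ::
    "('a, 'b) monoid_scheme \<Rightarrow> 'a set \<Rightarrow> real \<Rightarrow> ('a \<Rightarrow> 'a \<Rightarrow> 'a \<Rightarrow> 'a) \<Rightarrow> bool" where
  "coarse_median G A K \<mu> \<longleftrightarrow> 0 \<le> K \<and>
     (\<forall>x\<in>carrier G. \<forall>y\<in>carrier G. \<forall>z\<in>carrier G.
        K_center G A K x y z (\<mu> x y z) \<and> \<mu> x y z = \<mu> y x z \<and> \<mu> x y z = \<mu> x z y) \<and>
     (\<forall>a\<in>carrier G. \<forall>b\<in>carrier G. \<mu> a a b = a)"

definition coarse_median_preserving ::
    "('a, 'b) monoid_scheme \<Rightarrow> 'a set \<Rightarrow> ('a \<Rightarrow> 'a \<Rightarrow> 'a \<Rightarrow> 'a) \<Rightarrow> ('a \<Rightarrow> 'a) \<Rightarrow> bool" where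
  "coarse_median_preserving G A \<mu> \<phi> \<longleftrightarrow>
     (\<exists>C\<ge>0. \<forall>x\<in>carrier G. \<forall>y\<in>carrier G. \<forall>z\<in>carrier G.
        word_dist G A (\<phi> (\<mu> x y z)) (\<mu> (\<phi> x) (\<phi> y) (\<phi> z)) \<le> C)"

section \<open>Existence of coarse medians in a hyperbolic group\<close>

locale fg_group = group G for G (structure) +
  fixes A :: "'a set"
  assumes A_sub: "A \<subseteq> carrier G" and A_gen: "generate G A = carrier G"
begin

abbreviation S where "S \<equiv> A \<union> m_inv G ` A"
abbreviation d where "d \<equiv> word_dist G A"
abbreviation wprod where "wprod ws \<equiv> foldr (\<otimes>) ws \<one>"

lemma S_sub: "S \<subseteq> carrier G"
  using A_sub by auto

lemma wprod_closed: "set ws \<subseteq> S \<Longrightarrow> wprod ws \<in> carrier G"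
  using S_sub by (induction ws) auto

lemma wprod_append:
  "set xs \<subseteq> S \<Longrightarrow> set ys \<subseteq> S \<Longrightarrow> wprod (xs @ ys) = wprod xs \<otimes> wprod ys"
proof (induction xs)
  case Nil then show ?case using wprod_closed[of ys] by simp
next
  case (Cons a xs)
  then show ?case using wprod_closed[of ys] wprod_closed[of xs] S_sub
    by (auto simp: m_assoc subset_iff)
qed

lemma S_inv: "s \<in> S \<Longrightarrow> inv s \<in> S"
  using A_sub by auto

lemma wprod_inv: "set ws \<subseteq> S \<Longrightarrow> set (rev (map (m_inv G) ws)) \<subseteq> S \<and> 
    wprod (rev (map (m_inv G) ws)) = inv (wprod ws)"
proof (induction ws)
  case Nil then show ?case by simp
next
  case (Cons a ws)
  then have a: "a \<in> S" "a \<in> carrier G" using S_sub by auto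
  have 1: "set (rev (map (m_inv G) ws)) \<subseteq> S" "set [inv a] \<subseteq> S" using Cons S_inv a by auto
  have "wprod (rev (map (m_inv G) (a # ws))) = inv (wprod ws) \<otimes> inv a"
    using wprod_append[OF 1] Cons a by simp
  then show ?case using 1 a wprod_closed[of ws] Cons.prems by (auto simp: inv_mult_group)
qed

lemma word_exists: "g \<in> carrier G \<Longrightarrow> \<exists>ws. set ws \<subseteq> S \<and> wprod ws = g"
proof -
  assume "g \<in> carrier G"
  then have "g \<in> generate G A" using A_gen by simp
  then show ?thesis
  proof (induction rule: generate.induct)
    case one show ?case by (rule exI[of _ "[]"]) simp
  next
    case (incl h) then show ?case using A_sub by (intro exI[of _ "[h]"]) auto
  next
    case (inv h) then show ?case using A_sub by (intro exI[of _ "[inv h]"]) auto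
  next
    case (eng h1 h2)
    then obtain w1 w2 where "set w1 \<subseteq> S" "wprod w1 = h1" "set w2 \<subseteq> S" "wprod w2 = h2" by blast
    then show ?case using wprod_append[of w1 w2] by (intro exI[of _ "w1 @ w2"]) auto
  qed
qed

lemma d_le: "set ws \<subseteq> S \<Longrightarrow> wprod ws = inv x \<otimes> y \<Longrightarrow> d x y \<le> length ws"
  unfolding word_dist_def by (auto intro: Least_le)

lemma d_word:
  assumes "x \<in> carrier G" "y \<in> carrier G"
  obtains ws where "set ws \<subseteq> S" "wprod ws = inv x \<otimes> y" "d x y = length ws"
proof -
  let ?P = "\<lambda>n. \<exists>ws. length ws = n \<and> set ws \<subseteq> S \<and> wprod ws = inv x \<otimes> y"
  have "\<exists>n. ?P n" using word_exists[of "inv x \<otimes> y"] assms by auto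
  then have "?P (Least ?P)" by (rule LeastI_ex)
  then show ?thesis using that unfolding word_dist_def by auto
qed

lemma d_ge0: "0 \<le> d x y"
  by (simp add: word_dist_def)

lemma d_refl: "x \<in> carrier G \<Longrightarrow> d x x = 0"
  using d_le[of "[]" x x] d_ge0[of x x] by simp

lemma d_eq0: "x \<in> carrier G \<Longrightarrow> y \<in> carrier G \<Longrightarrow> d x y = 0 \<Longrightarrow> x = y"
  using d_word[of x y] by (metis foldr.simps(1) id_apply inv_closed inv_equality inv_inv length_0_conv of_nat_eq_0_iff)

lemma d_tri:
  assumes "x \<in> carrier G" "y \<in> carrier G" "z \<in> carrier G"
  shows "d x z \<le> d x y + d y z"
proof -
  obtain v where v: "set v \<subseteq> S" "wprod v = inv x \<otimes> y" "d x y = length v" using d_word assms by metis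
  obtain w where w: "set w \<subseteq> S" "wprod w = inv y \<otimes> z" "d y z = length w" using d_word assms by metis
  have "(inv x \<otimes> y) \<otimes> (inv y \<otimes> z) = inv x \<otimes> z"
    using assms by (metis inv_closed inv_solve_left m_assoc m_closed)
  then have "wprod (v @ w) = inv x \<otimes> z" using wprod_append[OF v(1) w(1)] v(2) w(2) by metis
  then show ?thesis using d_le[of "v @ w" x z] v w by simp
qed

lemma d_sym:
  assumes "x \<in> carrier G" "y \<in> carrier G" shows "d x y = d y x"
proof -
  have "d y x \<le> d x y" if xy: "x \<in> carrier G" "y \<in> carrier G" for x y
  proof -
    obtain v where v: "set v \<subseteq> S" "wprod v = inv x \<otimes> y" "d x y = length v" using d_word xy by metis
    have "wprod (rev (map (m_inv G) v)) = inv y \<otimes> x" using wprod_inv v xy by (simp add: inv_mult_group)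
    then show ?thesis using d_le[of "rev (map (m_inv G) v)" y x] wprod_inv v by simp
  qed
  then show ?thesis using assms by (simp add: order_antisym)
qed

lemma edge_d: "cayley_edge G A g h \<Longrightarrow> d g h \<le> 1"
proof -
  assume e: "cayley_edge G A g h"
  then obtain a where a: "a \<in> A" "h = g \<otimes> a \<or> g = h \<otimes> a" "g \<in> carrier G" "h \<in> carrier G"
    by (auto simp: cayley_edge_def)
  have ac: "a \<in> carrier G" using a A_sub by auto
  show ?thesis using a(2)
  proof
    assume "h = g \<otimes> a"
    then show ?thesis using d_le[of "[a]" g h] a ac by (simp flip: m_assoc)
  next
    assume "g = h \<otimes> a"
    then show ?thesis using d_le[of "[a]" h g] a ac d_sym[of g h] by (simp flip: m_assoc)
  qed
qed

lemma d_edge: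
  assumes "x \<in> carrier G" "y \<in> carrier G" "d x y = 1" shows "cayley_edge G A x y"
proof -
  obtain w where w: "set w \<subseteq> S" "wprod w = inv x \<otimes> y" "d x y = length w" using d_word assms by metis
  then obtain s where s: "w = [s]" using assms by (cases w) auto
  have sc: "s \<in> carrier G" using s w S_sub by auto
  have y: "y = x \<otimes> s" using w s sc assms by (simp add: inv_solve_left)
  have "x \<noteq> y" using assms d_refl by force
  moreover have "\<exists>a\<in>A. y = x \<otimes> a \<or> x = y \<otimes> a"
  proof (cases "s \<in> A")
    case False
    then obtain a where a: "a \<in> A" "s = inv a" using w s by auto
    then have "x = y \<otimes> a" using y assms A_sub by (auto simp: m_assoc subset_iff)
    then show ?thesis using a by blast
  qed (use y in blast)
  ultimately show ?thesis using assms by (auto simp: cayley_edge_def)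
qed

lemma geodesic_exists:
  assumes x: "x \<in> carrier G" "y \<in> carrier G"
  obtains n \<xi> where "geodesic G A x y n \<xi>"
proof -
  obtain w where w: "set w \<subseteq> S" "wprod w = inv x \<otimes> y" "d x y = length w" using d_word assms by metis
  define \<xi> where "\<xi> i = x \<otimes> wprod (take i w)" for i
  have sub: "set (take i w) \<subseteq> S" "set (drop i w) \<subseteq> S" for i using w set_take_subset set_drop_subset by fast+
  have xc: "\<xi> i \<in> carrier G" for i using wprod_closed[OF sub(1)] x by (simp add: \<xi>_def)
  have le: "d (\<xi> i) (\<xi> j) \<le> real j - real i" if "i \<le> j" "j \<le> length w" for i j
  proof -
    have s2: "set (take (j - i) (drop i w)) \<subseteq> S" using sub(2)[of i] set_take_subset by fast
    have "take j w = take i w @ take (j - i) (drop i w)" using that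
      by (metis le_add_diff_inverse take_add)
    then have "\<xi> j = \<xi> i \<otimes> wprod (take (j - i) (drop i w))"
      using wprod_append[OF sub(1) s2, of i] wprod_closed[OF sub(1), of i] wprod_closed[OF s2] x
      by (simp add: \<xi>_def m_assoc)
    then have "wprod (take (j - i) (drop i w)) = inv (\<xi> i) \<otimes> \<xi> j"
      using xc[of i] wprod_closed[OF s2] by (simp flip: m_assoc)
    from d_le[OF s2 this] show ?thesis using that by auto
  qed
  have 0: "\<xi> 0 = x" using x by (simp add: \<xi>_def)
  have n: "\<xi> (length w) = y" using x w by (simp add: \<xi>_def inv_solve_left' flip: m_assoc)
  have eq: "d (\<xi> i) (\<xi> j) = real j - real i" if "i \<le> j" "j \<le> length w" for i j
  proof -
    have "d x y \<le> d (\<xi> 0) (\<xi> i) + (d (\<xi> i) (\<xi> j) + d (\<xi> j) (\<xi> (length w)))"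
      using d_tri[of x "\<xi> i" y] d_tri[of "\<xi> i" "\<xi> j" y] xc x 0 n by simp
    then show ?thesis using w(3) le[of 0 i] le[of i j] le[of j "length w"] that by simp
  qed
  have "geodesic G A x y (length w) \<xi>"
    unfolding geodesic_def
  proof (intro conjI allI impI xc 0 n)
    fix i j assume "i \<le> length w" "j \<le> length w"
    then show "d (\<xi> i) (\<xi> j) = \<bar>real i - real j\<bar>"
      using eq[of i j] eq[of j i] d_sym[OF xc xc, of i j] by (cases "i \<le> j") auto
  qed
  then show ?thesis using that by blast
qed

lemma geodesic_rev:
  assumes "geodesic G A x y n \<xi>" shows "geodesic G A y x n (\<lambda>i. \<xi> (n - i))"
  using assms unfolding geodesic_def by (auto simp: of_nat_diff)

lemma rev_img: "(\<lambda>i. \<xi> (n - i)) ` {..n} = \<xi> ` {..n::nat}"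
proof -
  have "\<xi> i \<in> (\<lambda>i. \<xi> (n - i)) ` {..n}" if "i \<le> n" for i
    by (rule image_eqI[of _ _ "n - i"]) (use that in auto)
  then show ?thesis by auto
qed

text \<open>The path in the Cayley graph traced by a geodesic on vertices: \<open>hat n \<xi> t\<close> is the point at
  distance \<open>t\<close> from \<open>\<xi> 0\<close>.\<close>

definition hat :: "nat \<Rightarrow> (nat \<Rightarrow> 'a) \<Rightarrow> real \<Rightarrow> 'a \<Rightarrow> real" where
  "hat n \<xi> t x = (\<Sum>i | i \<le> n \<and> \<xi> i = x. max 0 (1 - \<bar>t - real i\<bar>))"

context
  fixes x y n \<xi> assumes geo: "geodesic G A x y n \<xi>"
begin

lemma geo_inj: "i \<le> n \<Longrightarrow> j \<le> n \<Longrightarrow> \<xi> i = \<xi> j \<longleftrightarrow> i = j"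
  using geo d_refl[of "\<xi> i"] unfolding geodesic_def
  by (metis abs_eq_0 eq_iff_diff_eq_0 of_nat_eq_iff)

lemma hat_at: "i \<le> n \<Longrightarrow> hat n \<xi> t (\<xi> i) = max 0 (1 - \<bar>t - real i\<bar>)"
proof -
  assume "i \<le> n"
  then have "{j. j \<le> n \<and> \<xi> j = \<xi> i} = {i}" using geo_inj by auto
  then show ?thesis by (simp add: hat_def)
qed

lemma hat_out: "z \<notin> \<xi> ` {..n} \<Longrightarrow> hat n \<xi> t z = 0"
  unfolding hat_def by (rule sum.neutral) auto

lemma supp_hat: "supp (hat n \<xi> t) = \<xi> ` {i. i \<le> n \<and> \<bar>t - real i\<bar> < 1}"
proof (intro equalityI subsetI)
  fix z assume z: "z \<in> supp (hat n \<xi> t)"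
  then have "z \<in> \<xi> ` {..n}" using hat_out[of z t] by (auto simp: supp_def)
  then obtain i where i: "i \<le> n" "z = \<xi> i" by auto
  then show "z \<in> \<xi> ` {i. i \<le> n \<and> \<bar>t - real i\<bar> < 1}" using z hat_at[of i t] by (auto simp: supp_def)
qed (auto simp: supp_def hat_at)

lemma xi_c: "i \<le> n \<Longrightarrow> \<xi> i \<in> carrier G"
  using geo by (auto simp: geodesic_def)

lemma xi_d: "i \<le> n \<Longrightarrow> j \<le> n \<Longrightarrow> d (\<xi> i) (\<xi> j) = \<bar>real i - real j\<bar>"
  using geo by (auto simp: geodesic_def)

lemma xi_edge: "Suc i \<le> n \<Longrightarrow> cayley_edge G A (\<xi> i) (\<xi> (Suc i))"
  by (rule d_edge) (auto simp: xi_c xi_d)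

lemma hat_point:
  assumes t: "0 \<le> t" "t \<le> real n" shows "hat n \<xi> t \<in> cayley_points G A"
proof -
  have nn: "0 \<le> hat n \<xi> t z" for z unfolding hat_def by (rule sum_nonneg) auto
  define i where "i = nat \<lfloor>t\<rfloor>"
  have i: "real i \<le> t" "t < real i + 1" "i \<le> n" using t unfolding i_def by linarith+
  have ex: "\<exists>g\<in>carrier G. \<exists>h\<in>carrier G. (g = h \<or> cayley_edge G A g h) \<and>
        supp (hat n \<xi> t) \<subseteq> {g, h} \<and> (\<Sum>x\<in>{g, h}. hat n \<xi> t x) = 1"
  proof (cases "i = n")
    case True
    then have "t = real n" using i t by simp
    then show ?thesis using xi_c[of n]
      by (intro bexI[of _ "\<xi> n"]) (auto simp: supp_hat hat_at intro!: arg_cong[of _ _ \<xi>])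
  next
    case False
    then have si: "Suc i \<le> n" using i by simp
    have ne: "\<xi> i \<noteq> \<xi> (Suc i)" using geo_inj[of i "Suc i"] si by simp
    have "j = i \<or> j = Suc i" if "\<bar>t - real j\<bar> < 1" for j using that i by linarith
    then have "supp (hat n \<xi> t) \<subseteq> {\<xi> i, \<xi> (Suc i)}" unfolding supp_hat by auto
    moreover have "(\<Sum>x\<in>{\<xi> i, \<xi> (Suc i)}. hat n \<xi> t x) = 1"
      using ne si i by (simp add: hat_at)
    ultimately show ?thesis using xi_edge[OF si] xi_c si i(3) by blast
  qed
  then show ?thesis using nn by (simp add: cayley_points_def)
qed

lemma hat_dist_le:
  assumes st: "0 \<le> s" "s \<le> t" "t \<le> real n"
  shows "cayley_dist G A (hat n \<xi> s) (hat n \<xi> t) = t - s \<and> cayley_dist G A (hat n \<xi> t) (hat n \<xi> s) = t - s"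
proof -
  let ?p = "hat n \<xi> s" and ?q = "hat n \<xi> t"
  let ?E = "\<lambda>p q. \<exists>g\<in>carrier G. \<exists>h\<in>carrier G. (g = h \<or> cayley_edge G A g h) \<and> supp p \<union> supp q \<subseteq> {g, h}"
  have Esym: "?E ?q ?p = ?E ?p ?q" by (simp add: Un_commute)
  define i where "i = nat \<lfloor>s\<rfloor>"
  define j where "j = nat \<lceil>t\<rceil>"
  have i: "real i \<le> s" "s < real i + 1" "i \<le> n" using st unfolding i_def by linarith+
  have j: "t \<le> real j" "real j < t + 1" "j \<le> n" using st unfolding j_def by linarith+
  have ij: "i \<le> j" using i j st by linarith
  show ?thesis
  proof (cases "?E ?p ?q")
    case True
    then obtain g h where gh: "g \<in> carrier G" "h \<in> carrier G" "g = h \<or> cayley_edge G A g h" "supp ?p \<union> supp ?q \<subseteq> {g,h}"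
      by blast
    have "\<xi> i \<in> supp ?p" "\<xi> j \<in> supp ?q" using i j unfolding supp_hat by auto
    then have m: "\<xi> i \<in> {g,h}" "\<xi> j \<in> {g,h}" using gh by auto
    have "d (\<xi> i) (\<xi> j) \<le> 1"
      using m gh edge_d d_sym d_refl by (metis insertE singletonD zero_le_one)
    then have ij1: "real j - real i \<le> 1" using xi_d i j ij by simp
    let ?I = "{i..j}"
    have supsub: "supp ?p \<union> supp ?q \<subseteq> \<xi> ` ?I"
    proof -
      have "k \<in> ?I" if "\<bar>s - real k\<bar> < 1 \<or> \<bar>t - real k\<bar> < 1" "k \<le> n" for k
      proof (rule ccontr)
        assume "k \<notin> ?I"
        then have kij: "k < i \<or> j < k" by auto
        have "\<xi> k \<in> {g,h}" using that gh(4) unfolding supp_hat by auto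
        then have dd: "d (\<xi> i) (\<xi> k) \<le> 1" "d (\<xi> j) (\<xi> k) \<le> 1"
          using m gh edge_d d_sym d_refl by (metis insertE singletonD zero_le_one)+
        then have "\<bar>real i - real k\<bar> \<le> 1" "\<bar>real j - real k\<bar> \<le> 1" using xi_d i j that by auto
        then have "i = j" using kij ij by linarith
        then have "s = real i" "t = real i" using i j st by linarith+
        then show False using that(1) kij \<open>i = j\<close> by linarith
      qed
      then show ?thesis unfolding supp_hat by auto
    qed
    have "(\<Sum>x\<in>supp ?p \<union> supp ?q. \<bar>?p x - ?q x\<bar>) = (\<Sum>x\<in>\<xi> ` ?I. \<bar>?p x - ?q x\<bar>)"
      by (rule sum.mono_neutral_left) (use supsub in \<open>auto simp: supp_def\<close>)
    also have "\<dots> = (\<Sum>k\<in>?I. \<bar>?p (\<xi> k) - ?q (\<xi> k)\<bar>)"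
      by (rule sum.reindex_cong[of \<xi>]) (use geo_inj j in \<open>auto simp: inj_on_def\<close>)
    also have "\<dots> = 2 * (t - s)"
    proof (cases "i = j")
      case True
      then have "s = t" using i j st by linarith
      then show ?thesis by simp
    next
      case False
      then have "j = Suc i" using ij ij1 by linarith
      then have "?I = {i, Suc i}" by auto
      then show ?thesis using i j st \<open>j = Suc i\<close> by (simp add: hat_at)
    qed
    finally have sm: "(\<Sum>x\<in>supp ?p \<union> supp ?q. \<bar>?p x - ?q x\<bar>) = 2 * (t - s)" .
    moreover have "(\<Sum>x\<in>supp ?q \<union> supp ?p. \<bar>?q x - ?p x\<bar>) = (\<Sum>x\<in>supp ?p \<union> supp ?q. \<bar>?p x - ?q x\<bar>)"
      by (simp add: Un_commute abs_minus_commute)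
    ultimately show ?thesis unfolding cayley_dist_def using Esym True by simp
  next
    case False
    have ij2: "\<not> j \<le> Suc i"
    proof
      assume h: "j \<le> Suc i"
      have "k = i \<or> k = j" if "\<bar>s - real k\<bar> < 1 \<or> \<bar>t - real k\<bar> < 1" "k \<le> n" "j = Suc i" for k
        using that i j st h ij by auto
      moreover have "k = i" if "\<bar>s - real k\<bar> < 1 \<or> \<bar>t - real k\<bar> < 1" "k \<le> n" "j = i" for k
        using that i j st h ij by auto
      ultimately have "supp ?p \<union> supp ?q \<subseteq> {\<xi> i, \<xi> j}" unfolding supp_hat using h ij by (cases "j = i") auto
      moreover have "\<xi> i = \<xi> j \<or> cayley_edge G A (\<xi> i) (\<xi> j)" using h ij xi_edge[of i] j by (cases "j = i") (auto simp: le_Suc_eq)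
      ultimately show False using False xi_c i j by blast
    qed
    define a where "a = nat \<lceil>s\<rceil>"
    define b where "b = nat \<lfloor>t\<rfloor>"
    have a: "s \<le> real a" "real a < s + 1" "a \<le> n" using st unfolding a_def by linarith+
    have b: "real b \<le> t" "t < real b + 1" "b \<le> n" using st unfolding b_def by linarith+
    have "a \<le> Suc i" using a(2) i(2) by linarith
    moreover have "j \<le> Suc b" using b(2) j(2) by linarith
    ultimately have ab: "a \<le> b" using ij2 by linarith
    have fin: "finite (supp (hat n \<xi> r))" for r unfolding supp_hat by auto
    have mem: "\<xi> a \<in> supp ?p" "\<xi> b \<in> supp ?q" using a b unfolding supp_hat by auto
    have lo: "t - s \<le> (1 - ?p g) + d g h + (1 - ?q h)" if gh: "g \<in> supp ?p" "h \<in> supp ?q" for g h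
    proof -
      obtain k l where kl: "g = \<xi> k" "k \<le> n" "\<bar>s - real k\<bar> < 1" "h = \<xi> l" "l \<le> n" "\<bar>t - real l\<bar> < 1"
        using gh unfolding supp_hat by auto
      show ?thesis using kl xi_d[of k l] by (simp add: hat_at)
    qed
    have val: "(1 - ?p (\<xi> a)) + d (\<xi> a) (\<xi> b) + (1 - ?q (\<xi> b)) = t - s"
      using a b ab xi_d[of a b] by (simp add: hat_at)
    have symd: "d g h = d h g" if gh: "g \<in> supp ?p" "h \<in> supp ?q" for g h
      using gh xi_c d_sym unfolding supp_hat by auto
    have "Min ((\<lambda>(g, h). (1 - ?p g) + d g h + (1 - ?q h)) ` (supp ?p \<times> supp ?q)) = t - s"
      by (rule Min_eqI) (use fin lo val mem in \<open>force+\<close>)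
    moreover have "Min ((\<lambda>(g, h). (1 - ?q g) + d g h + (1 - ?p h)) ` (supp ?q \<times> supp ?p)) = t - s"
    proof (rule Min_eqI)
      show "finite ((\<lambda>(g, h). (1 - ?q g) + d g h + (1 - ?p h)) ` (supp ?q \<times> supp ?p))" using fin by simp
    next
      fix v assume "v \<in> (\<lambda>(g, h). (1 - ?q g) + d g h + (1 - ?p h)) ` (supp ?q \<times> supp ?p)"
      then obtain h g where "h \<in> supp ?q" "g \<in> supp ?p" "v = (1 - ?q h) + d h g + (1 - ?p g)" by auto
      then show "t - s \<le> v" using lo[of g h] symd[of g h] by simp
    next
      show "t - s \<in> (\<lambda>(g, h). (1 - ?q g) + d g h + (1 - ?p h)) ` (supp ?q \<times> supp ?p)"
        by (rule image_eqI[of _ _ "(\<xi> b, \<xi> a)"]) (use val mem symd[OF mem] in auto)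
    qed
    ultimately show ?thesis unfolding cayley_dist_def using Esym False by (simp only: if_False)
  qed
qed

lemma hat_segment:
  "geodesic_segment (cayley_points G A) (cayley_dist G A) (hat n \<xi> 0) (hat n \<xi> (real n)) (hat n \<xi> ` {0..real n})"
  unfolding geodesic_segment_def
proof (intro exI[of _ "real n"] exI[of _ "hat n \<xi>"] conjI ballI refl)
  fix s t assume "s \<in> {0..real n}" "t \<in> {0..real n}"
  then show "cayley_dist G A (hat n \<xi> s) (hat n \<xi> t) = \<bar>s - t\<bar>"
    using hat_dist_le[of s t] hat_dist_le[of t s] by (cases "s \<le> t") auto
qed (auto simp: hat_point)

lemma hat_vertex: "i \<le> n \<Longrightarrow> hat n \<xi> (real i) = (\<lambda>z. if z = \<xi> i then 1 else 0)"
proof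
  fix z assume i: "i \<le> n"
  show "hat n \<xi> (real i) z = (if z = \<xi> i then 1 else 0)"
  proof (cases "z \<in> \<xi> ` {..n}")
    case True
    then obtain k where "k \<le> n" "z = \<xi> k" by auto
    then show ?thesis using i geo_inj[of k i] by (auto simp: hat_at)
  qed (use i hat_out in auto)
qed

end

lemma near_vertex:
  assumes g: "g \<in> carrier G" and q: "supp q \<subseteq> carrier G" "supp q \<noteq> {}" "finite (supp q)" "\<And>x. q x \<le> 1"
  shows "\<exists>h\<in>supp q. d g h \<le> cayley_dist G A (\<lambda>z. if z = g then 1 else 0) q + 1"
proof -
  let ?p = "\<lambda>z. if z = g then 1 else (0::real)"
  have sp: "supp ?p = {g}" by (auto simp: supp_def)
  show ?thesis
  proof (cases "\<exists>e\<in>carrier G. \<exists>f\<in>carrier G. (e = f \<or> cayley_edge G A e f) \<and> supp ?p \<union> supp q \<subseteq> {e, f}")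
    case True
    then obtain e f where ef: "e\<in>carrier G" "f\<in>carrier G" "e = f \<or> cayley_edge G A e f" "supp ?p \<union> supp q \<subseteq> {e, f}"
      by blast
    obtain h where h: "h \<in> supp q" using q by auto
    have "g \<in> {e,f}" "h \<in> {e,f}" using ef sp h by auto
    then have "d g h \<le> 1" using ef edge_d d_sym d_refl by (metis insertE singletonD zero_le_one)
    moreover have "0 \<le> cayley_dist G A ?p q" unfolding cayley_dist_def using True by (auto intro!: sum_nonneg)
    ultimately show ?thesis using h by (intro bexI[of _ h]) linarith+
  next
    case False
    let ?M = "(\<lambda>(g, h). (1 - ?p g) + d g h + (1 - q h)) ` (supp ?p \<times> supp q)"
    have "finite ?M" "?M \<noteq> {}" using q sp by auto
    then have "Min ?M \<in> ?M" by (rule Min_in)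
    then obtain h where h: "h \<in> supp q" "Min ?M = d g h + (1 - q h)" using sp by auto
    have "cayley_dist G A ?p q = Min ?M" unfolding cayley_dist_def using False by auto
    then show ?thesis using h q(4)[of h] by force
  qed
qed

definition thin where
  "thin D \<longleftrightarrow> (\<forall>x y z l \<alpha> m \<beta> n \<gamma>. geodesic G A x y l \<alpha> \<and> geodesic G A y z m \<beta> \<and> geodesic G A z x n \<gamma> \<longrightarrow>
     (\<forall>i\<le>l. \<exists>h\<in>\<beta> ` {..m} \<union> \<gamma> ` {..n}. d (\<alpha> i) h \<le> D))"

lemma hyperbolic_thin:
  assumes "hyperbolic_group G A"
  shows "\<exists>D\<ge>0. thin D"
proof -
  obtain \<delta> where d0: "\<delta> \<ge> 0" and dh: "delta_hyperbolic (cayley_points G A) (cayley_dist G A) \<delta>"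
    using assms by (auto simp: hyperbolic_group_def)
  have "thin (\<delta> + 2)"
    unfolding thin_def
  proof (intro allI impI)
    fix x y z l \<alpha> m \<beta> n \<gamma> i
    assume "geodesic G A x y l \<alpha> \<and> geodesic G A y z m \<beta> \<and> geodesic G A z x n \<gamma>" and i: "i \<le> l"
    then have g: "geodesic G A x y l \<alpha>" "geodesic G A y z m \<beta>" "geodesic G A z x n \<gamma>" by auto
    have ends: "\<alpha> 0 = x" "\<alpha> l = y" "\<beta> 0 = y" "\<beta> m = z" "\<gamma> 0 = z" "\<gamma> n = x" using g by (auto simp: geodesic_def)
    let ?v = "\<lambda>g z. if z = g then 1 else (0::real)"
    have sg: "geodesic_segment (cayley_points G A) (cayley_dist G A) (?v x) (?v y) (hat l \<alpha> ` {0..real l})"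
      using hat_segment[OF g(1)] hat_vertex[OF g(1), of 0] hat_vertex[OF g(1), of l] ends by simp
    have sb: "geodesic_segment (cayley_points G A) (cayley_dist G A) (?v y) (?v z) (hat m \<beta> ` {0..real m})"
      using hat_segment[OF g(2)] hat_vertex[OF g(2), of 0] hat_vertex[OF g(2), of m] ends by simp
    have sc: "geodesic_segment (cayley_points G A) (cayley_dist G A) (?v z) (?v x) (hat n \<gamma> ` {0..real n})"
      using hat_segment[OF g(3)] hat_vertex[OF g(3), of 0] hat_vertex[OF g(3), of n] ends by simp
    have pts: "?v x \<in> cayley_points G A" "?v y \<in> cayley_points G A" "?v z \<in> cayley_points G A"
      using hat_point[OF g(1), of 0] hat_vertex[OF g(1), of 0] hat_point[OF g(2), of 0] hat_vertex[OF g(2), of 0]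
        hat_point[OF g(3), of 0] hat_vertex[OF g(3), of 0] ends by auto
    let ?U = "hat m \<beta> ` {0..real m} \<union> hat n \<gamma> ` {0..real n}"
    have "hat l \<alpha> (real i) \<in> nbhd (cayley_points G A) (cayley_dist G A) \<delta> ?U"
      using dh sg sb sc pts i unfolding delta_hyperbolic_def by fastforce
    then have "(INF q\<in>?U. cayley_dist G A (?v (\<alpha> i)) q) < \<delta> + 1"
      using hat_vertex[OF g(1) i] by (simp add: nbhd_def point_set_dist_def)
    moreover have "?U \<noteq> {}" by auto
    ultimately obtain q where q: "q \<in> ?U" "cayley_dist G A (?v (\<alpha> i)) q < \<delta> + 1"
      using cInf_lessD[of "cayley_dist G A (?v (\<alpha> i)) ` ?U" "\<delta> + 1"] by blast
    have key: "\<exists>h\<in>\<rho> ` {..k}. d (\<alpha> i) h \<le> \<delta> + 2"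
      if gr: "geodesic G A a b k \<rho>" and qt: "q = hat k \<rho> t" "0 \<le> t" "t \<le> real k" for a b k \<rho> t
    proof -
      have s: "supp q \<subseteq> \<rho> ` {..k}" using supp_hat[OF gr] qt by auto
      have "\<rho> (nat \<lfloor>t\<rfloor>) \<in> supp q" unfolding qt(1) supp_hat[OF gr]
        by (rule imageI) (use qt in \<open>auto, linarith+\<close>)
      moreover have "q z \<le> 1" for z
        using hat_at[OF gr] hat_out[OF gr, of z t] qt by (cases "z \<in> \<rho> ` {..k}") auto
      ultimately obtain h where "h \<in> supp q" "d (\<alpha> i) h \<le> cayley_dist G A (?v (\<alpha> i)) q + 1"
        using near_vertex[of "\<alpha> i" q] xi_c[OF g(1) i] xi_c[OF gr] s finite_subset[OF s] by blast
      then show ?thesis using s q(2) by force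
    qed
    show "\<exists>h\<in>\<beta> ` {..m} \<union> \<gamma> ` {..n}. d (\<alpha> i) h \<le> \<delta> + 2"
      using q(1)
    proof
      assume "q \<in> hat m \<beta> ` {0..real m}"
      then obtain t where "q = hat m \<beta> t" "0 \<le> t" "t \<le> real m" by auto
      from key[OF g(2) this] show ?thesis by blast
    next
      assume "q \<in> hat n \<gamma> ` {0..real n}"
      then obtain t where "q = hat n \<gamma> t" "0 \<le> t" "t \<le> real n" by auto
      from key[OF g(3) this] show ?thesis by blast
    qed
  qed
  then show ?thesis using d0 by (intro exI[of _ "\<delta> + 2"]) auto
qed

lemma bigon:
  assumes th: "thin D" "D \<ge> 0" and g: "geodesic G A x y l \<alpha>" "geodesic G A x y m \<beta>" and i: "i \<le> l"
  shows "\<exists>h\<in>\<beta> ` {..m}. d (\<alpha> i) h \<le> D"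
proof -
  have xc: "x \<in> carrier G" using g by (auto simp: geodesic_def)
  have c: "geodesic G A x x 0 (\<lambda>_. x)" using xc d_refl by (auto simp: geodesic_def)
  have 0: "x \<in> \<beta> ` {..m}" using g(2) by (auto simp: geodesic_def)
  have "\<exists>h\<in>(\<lambda>i. \<beta> (m - i)) ` {..m} \<union> (\<lambda>_. x) ` {..0::nat}. d (\<alpha> i) h \<le> D"
    using th(1) g(1) geodesic_rev[OF g(2)] c i unfolding thin_def by blast
  then show ?thesis using 0 by (auto simp: rev_img)
qed

lemma center_exists:
  assumes th: "thin D" "D \<ge> 0" and xyz: "x \<in> carrier G" "y \<in> carrier G" "z \<in> carrier G"
  shows "\<exists>c\<in>carrier G. \<forall>a\<in>{x,y,z}. \<forall>b\<in>{x,y,z}. a \<noteq> b \<longrightarrow>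
     (\<forall>k \<rho>. geodesic G A a b k \<rho> \<longrightarrow> (\<exists>h\<in>\<rho> ` {..k}. d c h \<le> 2 * D + 1))"
proof -
  obtain l \<alpha> where ga: "geodesic G A x y l \<alpha>" using geodesic_exists xyz by metis
  obtain m \<beta> where gb: "geodesic G A y z m \<beta>" using geodesic_exists xyz by metis
  obtain n \<gamma> where gc: "geodesic G A z x n \<gamma>" using geodesic_exists xyz by metis
  let ?B = "\<lambda>i. \<exists>h\<in>\<beta> ` {..m}. d (\<alpha> i) h \<le> D"
  let ?C = "\<lambda>i. \<exists>h\<in>\<gamma> ` {..n}. d (\<alpha> i) h \<le> D"
  have or: "?B i \<or> ?C i" if "i \<le> l" for i
    using th(1) ga gb gc that unfolding thin_def by (metis Un_iff)
  have "\<alpha> l = \<beta> 0" using ga gb by (simp add: geodesic_def)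
  then have Bl: "?B l" using th(2) d_refl xi_c[OF ga, of l] by force
  define i where "i = (LEAST i. ?B i)"
  have Bi: "?B i" unfolding i_def using Bl by (rule LeastI)
  have il: "i \<le> l" unfolding i_def using Bl by (rule Least_le)
  have ci: "\<alpha> i \<in> carrier G" using xi_c[OF ga il] .
  have C: "\<exists>h\<in>\<gamma> ` {..n}. d (\<alpha> i) h \<le> D + 1"
  proof (cases i)
    case 0
    have "\<alpha> 0 = \<gamma> n" using ga gc by (simp add: geodesic_def)
    then show ?thesis using th(2) d_refl ci 0 by force
  next
    case (Suc j)
    then have "\<not> ?B j" using not_less_Least[of j ?B] unfolding i_def by auto
    then obtain h where h: "h \<in> \<gamma> ` {..n}" "d (\<alpha> j) h \<le> D" using or[of j] Suc il by auto
    have "d (\<alpha> i) h \<le> d (\<alpha> i) (\<alpha> j) + d (\<alpha> j) h"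
      using d_tri ci xi_c[OF ga, of j] xi_c[OF gc] h Suc il by auto
    moreover have "d (\<alpha> i) (\<alpha> j) = 1" using xi_d[OF ga, of i j] Suc il by simp
    ultimately show ?thesis using h by force
  qed
  have B: "\<exists>h\<in>\<beta> ` {..m}. d (\<alpha> i) h \<le> D + 1" using Bi by force
  have A': "\<exists>h\<in>\<alpha> ` {..l}. d (\<alpha> i) h \<le> D + 1" using il d_refl[OF ci] th(2) by force
  have tr: "\<exists>h\<in>\<rho> ` {..k}. d (\<alpha> i) h \<le> 2 * D + 1"
    if g1: "geodesic G A a b k1 \<sigma>" and h: "\<exists>h\<in>\<sigma> ` {..k1}. d (\<alpha> i) h \<le> D + 1"
      and g2: "geodesic G A a b k \<rho>" for a b k1 \<sigma> k \<rho>
  proof -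
    obtain j where j: "j \<le> k1" "d (\<alpha> i) (\<sigma> j) \<le> D + 1" using h by auto
    obtain h where h: "h \<in> \<rho> ` {..k}" "d (\<sigma> j) h \<le> D" using bigon[OF th g1 g2 j(1)] by auto
    have "d (\<alpha> i) h \<le> d (\<alpha> i) (\<sigma> j) + d (\<sigma> j) h"
      using d_tri ci xi_c[OF g1 j(1)] xi_c[OF g2] h by auto
    then show ?thesis using j h by force
  qed
  have tr': "\<exists>h\<in>\<rho> ` {..k}. d (\<alpha> i) h \<le> 2 * D + 1"
    if "geodesic G A a b k1 \<sigma>" "\<exists>h\<in>\<sigma> ` {..k1}. d (\<alpha> i) h \<le> D + 1"
      and "geodesic G A b a k \<rho>" for a b k1 \<sigma> k \<rho>
    using tr[OF that(1,2) geodesic_rev[OF that(3)]] by (simp add: rev_img)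
  show ?thesis
    using ci tr[OF ga A'] tr[OF gb B] tr[OF gc C] tr'[OF ga A'] tr'[OF gb B] tr'[OF gc C]
    by (intro bexI[of _ "\<alpha> i"]) auto
qed

lemma pt_le: "h \<in> Y \<Longrightarrow> d c h \<le> K \<Longrightarrow> point_set_dist d c Y \<le> K"
  unfolding point_set_dist_def by (rule cINF_lower2) (auto intro!: bdd_belowI2[of _ 0] d_ge0)

lemma coarse_median_exists:
  assumes "hyperbolic_group G A" shows "\<exists>K \<mu>. coarse_median G A K \<mu>"
proof -
  obtain D where th: "D \<ge> 0" "thin D" using hyperbolic_thin[OF assms] by auto
  define P where "P T c \<longleftrightarrow> c \<in> carrier G \<and> (\<forall>a\<in>T. \<forall>b\<in>T. a \<noteq> b \<longrightarrow>
     (\<forall>k \<rho>. geodesic G A a b k \<rho> \<longrightarrow> (\<exists>h\<in>\<rho> ` {..k}. d c h \<le> 2 * D + 1)))" for T c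
  define \<mu> where "\<mu> x y z = (if x = y then x else if y = z then y else if x = z then x else SOME c. P {x,y,z} c)" for x y z
  have "K_center G A (2 * D + 1) x y z (\<mu> x y z)" if "x \<in> carrier G" "y \<in> carrier G" "z \<in> carrier G" for x y z
  proof (cases "x = y \<or> y = z \<or> x = z")
    case True
    have \<mu>: "\<mu> x y z \<in> carrier G" using that True by (auto simp: \<mu>_def)
    have end_near: "point_set_dist d (\<mu> x y z) (\<rho> ` {..k}) \<le> 2 * D + 1"
      if "geodesic G A a b k \<rho>" "\<mu> x y z = a \<or> \<mu> x y z = b" for a b k \<rho>
    proof (rule pt_le)
      show "\<mu> x y z \<in> \<rho> ` {..k}"
        using that unfolding geodesic_def by (metis atMost_iff image_eqI le0 order_refl)
      show "d (\<mu> x y z) (\<mu> x y z) \<le> 2 * D + 1" using d_refl[OF \<mu>] th by simp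
    qed
    have "\<mu> x y z = x \<or> \<mu> x y z = y" "\<mu> x y z = y \<or> \<mu> x y z = z" "\<mu> x y z = z \<or> \<mu> x y z = x"
      using True by (auto simp: \<mu>_def)
    then show ?thesis unfolding K_center_def using end_near \<mu> by blast
  next
    case False
    have "\<exists>c. P {x,y,z} c" using center_exists[OF th(2,1) that] unfolding P_def by blast
    then have "P {x,y,z} (SOME c. P {x,y,z} c)" by (rule someI_ex)
    then have P: "P {x,y,z} (\<mu> x y z)" using False by (simp add: \<mu>_def)
    have "point_set_dist d (\<mu> x y z) (\<rho> ` {..k}) \<le> 2 * D + 1"
      if "geodesic G A a b k \<rho>" "a \<noteq> b" "a \<in> {x,y,z}" "b \<in> {x,y,z}" for a b k \<rho>
      using P that pt_le unfolding P_def by meson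
    then have side: "point_set_dist d (\<mu> x y z) (\<rho> ` {..k}) \<le> 2 * D + 1"
      if "geodesic G A a b k \<rho>" "(a, b) \<in> {(x, y), (y, z), (z, x)}" for a b k \<rho>
      using that False by blast
    have "\<mu> x y z \<in> carrier G" using P by (simp add: P_def)
    then show ?thesis unfolding K_center_def using side by blast
  qed
  moreover have "\<mu> x y z = \<mu> y x z \<and> \<mu> x y z = \<mu> x z y" for x y z
    unfolding \<mu>_def by (auto simp: insert_commute)
  ultimately have "coarse_median G A (2 * D + 1) \<mu>"
    unfolding coarse_median_def using th by (auto simp: \<mu>_def)
  then show ?thesis by blast
qed

end

theorem hyperbolic_group_has_coarse_median:
  assumes "group G" "A \<subseteq> carrier G" "generate G A = carrier G" "hyperbolic_group G A"
  shows "\<exists>K \<mu>. coarse_median G A K \<mu>"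
proof -
  interpret group G by fact
  interpret fg_group G A by unfold_locales (use assms in auto)
  show ?thesis using coarse_median_exists assms(4) .
qed

end

theory Submission
  imports Defs
begin

text \<open>
  For the Gromov product \<open>(x|y)\<^sub>w\<close> at an arbitrary base point, consider the statement \<open>M(p)\<close>: there
  is \<open>q\<close> such that \<open>(x|y)\<^sub>w \<le> p\<close> implies \<open>(x\<phi>|y\<phi>)\<^sub>w\<^sub>\<phi> \<le> q\<close>. A concatenation of geodesics
  \<open>[x,w] + [w,y]\<close> is a \<open>(1,p)\<close>-quasi-geodesic iff \<open>(x|y)\<^sub>w \<le> p/2\<close>, so by left invariance the BRP at
  \<open>p\<close> is \<open>M(p/2)\<close>, and (iii), (iv) are \<open>M(p)\<close> for all \<open>p\<close> and \<open>M(0)\<close>. The existence of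
  \<open>K\<close>-centers gives \<open>(x|y)\<^sub>w \<le> d(w,[x,y]) \<le> (x|y)\<^sub>w + 3K\<close>. Since \<open>\<phi>\<close> is Lipschitz, moving the
  base point onto \<open>[x,y]\<close> shows that \<open>M(0)\<close> implies \<open>M(p)\<close>; it also identifies (vi) with \<open>M(0)\<close>. The
  missing half of (v) is a discrete intermediate value argument along \<open>[x\<phi>,y\<phi>]\<close>. For (vii), a center of
  \<open>x, y, z\<close> is, up to bounded distance, a point at which the three Gromov products of the vertices are
  bounded, and a center of \<open>w, x, y\<close> is close to \<open>w\<close> when \<open>(x|y)\<^sub>w = 0\<close>.
\<close>

section \<open>Gromov products at an arbitrary base point\<close>

context fg_group
begin

text \<open>\<open>(x|y)_w\<close>: half of what passing through \<open>w\<close> adds to the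
  distance from \<open>x\<close> to \<open>y\<close>.\<close>

definition gprod :: "'a \<Rightarrow> 'a \<Rightarrow> 'a \<Rightarrow> real" where
  "gprod w x y = (d x w + d w y - d x y) / 2"

lemma d_translate:
  assumes "g \<in> carrier G" "x \<in> carrier G" "y \<in> carrier G"
  shows "d (g \<otimes> x) (g \<otimes> y) = d x y"
proof -
  have "inv (g \<otimes> x) \<otimes> (g \<otimes> y) = inv x \<otimes> (inv g \<otimes> (g \<otimes> y))"
    using assms by (simp add: inv_mult_group m_assoc)
  also have "\<dots> = inv x \<otimes> y" using assms by (simp flip: m_assoc)
  finally show ?thesis by (simp add: word_dist_def)
qed

lemma gprod_translate:
  assumes "g \<in> carrier G" "w \<in> carrier G" "x \<in> carrier G" "y \<in> carrier G"
  shows "gprod (g \<otimes> w) (g \<otimes> x) (g \<otimes> y) = gprod w x y"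
  using assms by (simp add: gprod_def d_translate)

lemma gromov_product_eq_gprod:
  assumes "u \<in> carrier G" "v \<in> carrier G"
  shows "gromov_product G A u v = gprod \<one> u v"
  using assms by (simp add: gromov_product_def word_norm_def gprod_def d_sym[of u \<one>])

lemma gprod_ge0:
  assumes "w \<in> carrier G" "x \<in> carrier G" "y \<in> carrier G"
  shows "0 \<le> gprod w x y"
  using d_tri[of x w y] assms by (simp add: gprod_def)

text \<open>The base point occurs in two terms, each changing by at most \<open>d w w'\<close>, and
  the sum is halved.\<close>

lemma gprod_base_le:
  assumes "w \<in> carrier G" "w' \<in> carrier G" "x \<in> carrier G" "y \<in> carrier G"
  shows "gprod w x y \<le> gprod w' x y + d w w'"
  using d_tri[of x w' w] d_tri[of w w' y] d_sym[of w w'] assms by (simp add: gprod_def field_simps)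

lemma geodesic_ends:
  assumes "geodesic G A x y n \<xi>"
  shows "x \<in> carrier G" "y \<in> carrier G" "\<xi> 0 = x" "\<xi> n = y" "d x y = real n"
  using assms xi_d[OF assms, of 0 n] by (auto simp: geodesic_def)

lemma geodesic_split:
  assumes "geodesic G A x y n \<xi>" "i \<le> n"
  shows "d x (\<xi> i) = real i" "d (\<xi> i) y = real n - real i"
  using xi_d[OF assms(1), of 0 i] xi_d[OF assms(1), of i n] geodesic_ends[OF assms(1)] assms(2)
  by auto

lemma gprod_on_geodesic:
  assumes "geodesic G A x y n \<xi>" "i \<le> n"
  shows "gprod (\<xi> i) x y = 0"
  using geodesic_split[OF assms] geodesic_ends[OF assms(1)] by (simp add: gprod_def)

text \<open>The product vanishes at base points on the geodesic, and moving the base point to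
  \<open>w\<close> costs at most the distance moved. The reverse estimate, with error
  \<open>3 * K\<close>, is \<open>near_geodesic_of_gprod\<close>.\<close>

lemma gprod_near_geodesic:
  assumes g: "geodesic G A x y n \<xi>" and i: "i \<le> n" and w: "w \<in> carrier G"
  shows "gprod w x y \<le> d w (\<xi> i)"
  using gprod_base_le[OF w xi_c[OF g i] geodesic_ends(1,2)[OF g]] gprod_on_geodesic[OF g i] by simp

section \<open>Distances to paths and concatenations of geodesics\<close>

lemma point_set_dist_path_le_iff:
  "point_set_dist d c (\<rho> ` {..k::nat}) \<le> r \<longleftrightarrow> (\<exists>i\<le>k. d c (\<rho> i) \<le> r)"
proof
  assume r: "point_set_dist d c (\<rho> ` {..k}) \<le> r"
  \<comment> \<open>The infimum over the finitely many points of a path is attained.\<close>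
  have "Min (d c ` \<rho> ` {..k}) \<in> d c ` \<rho> ` {..k}" by (rule Min_in) auto
  then obtain i where "i \<le> k" "Min (d c ` \<rho> ` {..k}) = d c (\<rho> i)" by blast
  then show "\<exists>i\<le>k. d c (\<rho> i) \<le> r"
    using r by (auto simp: point_set_dist_def cInf_eq_Min)
qed (auto intro: pt_le)

lemma path_subset_nbhd_iff:
  assumes "\<And>i. i \<le> m \<Longrightarrow> \<beta> i \<in> carrier G"
  shows "\<beta> ` {..m::nat} \<subseteq> nbhd (carrier G) d r (\<xi> ` {..n::nat}) \<longleftrightarrow>
    (\<forall>i\<le>m. \<exists>j\<le>n. d (\<beta> i) (\<xi> j) \<le> r)"
  using assms by (auto simp: nbhd_def point_set_dist_path_le_iff)

text \<open>Only indices on different pieces matter. The upper bound passes through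
  \<open>w\<close>. For the lower bound, \<open>d x y\<close> is at most the length of the route
  through both points, and the whole concatenation exceeds \<open>d x y\<close> by
  \<open>2 * gprod w x y\<close>.\<close>

lemma path_concat_geodesics:
  assumes a: "geodesic G A x w m \<alpha>" and b: "geodesic G A w y n \<beta>"
  shows "k \<le> m + n \<Longrightarrow> path_concat m \<alpha> \<beta> k \<in> carrier G"
    and "path_concat m \<alpha> \<beta> 0 = x" "path_concat m \<alpha> \<beta> m = w" "path_concat m \<alpha> \<beta> (m + n) = y"
    and "i \<le> j \<Longrightarrow> j \<le> m + n \<Longrightarrow>
      d (path_concat m \<alpha> \<beta> i) (path_concat m \<alpha> \<beta> j) \<le> real j - real i \<and>
      real j - real i - 2 * gprod w x y \<le> d (path_concat m \<alpha> \<beta> i) (path_concat m \<alpha> \<beta> j)"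
proof -
  note ea = geodesic_ends[OF a] and eb = geodesic_ends[OF b]
  show "path_concat m \<alpha> \<beta> k \<in> carrier G" if "k \<le> m + n"
    using that xi_c[OF a, of k] xi_c[OF b, of "k - m"] by (simp add: path_concat_def)
  show "path_concat m \<alpha> \<beta> 0 = x" "path_concat m \<alpha> \<beta> m = w" "path_concat m \<alpha> \<beta> (m + n) = y"
    using ea eb by (auto simp: path_concat_def)
  have g0: "0 \<le> gprod w x y" using gprod_ge0 ea eb by blast
  assume ij: "i \<le> j" "j \<le> m + n"
  consider "j \<le> m" | "m < i" | "i \<le> m" "m < j" by linarith
  then show "d (path_concat m \<alpha> \<beta> i) (path_concat m \<alpha> \<beta> j) \<le> real j - real i \<and>
      real j - real i - 2 * gprod w x y \<le> d (path_concat m \<alpha> \<beta> i) (path_concat m \<alpha> \<beta> j)"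
  proof cases
    case 1
    then show ?thesis using ij g0 xi_d[OF a, of i j] by (simp add: path_concat_def)
  next
    case 2
    then show ?thesis using ij g0 xi_d[OF b, of "i - m" "j - m"]
      by (simp add: path_concat_def of_nat_diff)
  next
    case 3
    define l where "l = j - m"
    have l: "j = m + l" "l \<le> n" using 3 ij by (auto simp: l_def)
    have c: "\<alpha> i \<in> carrier G" "\<beta> l \<in> carrier G" using xi_c[OF a] xi_c[OF b] 3 l by auto
    have "d (\<alpha> i) (\<beta> l) \<le> d (\<alpha> i) w + d w (\<beta> l)" using d_tri c ea by blast
    moreover have "d x y \<le> d x (\<alpha> i) + (d (\<alpha> i) (\<beta> l) + d (\<beta> l) y)"
      using d_tri[of x "\<alpha> i" y] d_tri[of "\<alpha> i" "\<beta> l" y] c ea eb by simp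
    ultimately show ?thesis
      using 3 l geodesic_split[OF a 3(1)] geodesic_split[OF b l(2)] ea(5) eb(5)
      by (simp add: path_concat_def gprod_def field_simps)
  qed
qed

text \<open>Among all pairs of indices the two end points lose the most length, namely
  \<open>2 * gprod w x y\<close>, so they alone decide.\<close>

lemma quasi_geodesic_path_concat_iff:
  assumes a: "geodesic G A x w m \<alpha>" and b: "geodesic G A w y n \<beta>" and p: "0 \<le> p"
  shows "quasi_geodesic G A 1 p (m + n) (path_concat m \<alpha> \<beta>) \<longleftrightarrow> gprod w x y \<le> p / 2"
proof
  assume "quasi_geodesic G A 1 p (m + n) (path_concat m \<alpha> \<beta>)"
  then have "1 / 1 * \<bar>real 0 - real (m + n)\<bar> - p
      \<le> d (path_concat m \<alpha> \<beta> 0) (path_concat m \<alpha> \<beta> (m + n))"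
    unfolding quasi_geodesic_def by blast
  then show "gprod w x y \<le> p / 2"
    using path_concat_geodesics(2,4)[OF a b] geodesic_ends(5)[OF a] geodesic_ends(5)[OF b]
    by (simp add: gprod_def)
next
  assume g: "gprod w x y \<le> p / 2"
  let ?c = "path_concat m \<alpha> \<beta>"
  show "quasi_geodesic G A 1 p (m + n) ?c"
    unfolding quasi_geodesic_def
  proof (intro conjI[rotated] allI impI)
    fix i j assume "i \<le> m + n" "j \<le> m + n"
    then have "\<bar>real i - real j\<bar> - p \<le> d (?c i) (?c j) \<and> d (?c i) (?c j) \<le> \<bar>real i - real j\<bar>"
      using path_concat_geodesics(5)[OF a b, of i j] path_concat_geodesics(5)[OF a b, of j i] g
        d_sym[OF path_concat_geodesics(1)[OF a b, of i] path_concat_geodesics(1)[OF a b, of j]]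
      by (cases "i \<le> j") auto
    then show "1 / 1 * \<bar>real i - real j\<bar> - p \<le> d (?c i) (?c j)"
      "d (?c i) (?c j) \<le> 1 * \<bar>real i - real j\<bar> + p" using p by auto
  qed (rule path_concat_geodesics(1)[OF a b])
qed

text \<open>A \<open>(1,0)\<close>-quasi-geodesic is a geodesic, so any geodesics from
  \<open>x\<close> to \<open>w\<close> and from \<open>w\<close> to \<open>y\<close> can be
  joined.\<close>

lemma geodesic_through:
  assumes "w \<in> carrier G" "x \<in> carrier G" "y \<in> carrier G" "gprod w x y = 0"
  obtains n \<xi> i where "geodesic G A x y n \<xi>" "i \<le> n" "\<xi> i = w"
proof -
  obtain m \<alpha> where a: "geodesic G A x w m \<alpha>" using geodesic_exists assms by metis
  obtain n \<beta> where b: "geodesic G A w y n \<beta>" using geodesic_exists assms by metis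
  have "quasi_geodesic G A 1 0 (m + n) (path_concat m \<alpha> \<beta>)"
    using quasi_geodesic_path_concat_iff[OF a b, of 0] assms by simp
  then have "geodesic G A x y (m + n) (path_concat m \<alpha> \<beta>)"
    using path_concat_geodesics(2,4)[OF a b] unfolding geodesic_def quasi_geodesic_def
    by (auto intro: antisym)
  then show ?thesis using that[of "m + n" _ m] path_concat_geodesics(3)[OF a b] by simp
qed

section \<open>The BRP and conditions (iii), (iv) as statements about \<open>gprod\<close>\<close>

lemma BRP_at_iff:
  assumes p: "0 \<le> p" and hom: "\<phi> \<in> hom G G"
  shows "BRP_at G A \<phi> p \<longleftrightarrow> (\<exists>q\<ge>0. \<forall>w\<in>carrier G. \<forall>x\<in>carrier G. \<forall>y\<in>carrier G.
    gprod w x y \<le> p / 2 \<longrightarrow> gprod (\<phi> w) (\<phi> x) (\<phi> y) \<le> q)"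
proof -
  interpret h: group_hom G G \<phi> by unfold_locales (rule hom)
  \<comment> \<open>Whether the concatenation is a quasi-geodesic does not depend on the geodesics
    chosen, and geodesics exist. Hence both quantifiers, the existential one in the premise of the
    BRP and the universal one in its conclusion, give the same bound.\<close>
  have iff: "(\<forall>m \<alpha> n \<beta>. geodesic G A a w m \<alpha> \<and> geodesic G A w b n \<beta> \<longrightarrow>
           quasi_geodesic G A 1 r (m + n) (path_concat m \<alpha> \<beta>)) \<longleftrightarrow> gprod w a b \<le> r / 2"
    "(\<exists>m \<alpha> n \<beta>. geodesic G A a w m \<alpha> \<and> geodesic G A w b n \<beta> \<and>
           quasi_geodesic G A 1 r (m + n) (path_concat m \<alpha> \<beta>)) \<longleftrightarrow> gprod w a b \<le> r / 2"
    if "0 \<le> r" "a \<in> carrier G" "w \<in> carrier G" "b \<in> carrier G" for r a w b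
    using quasi_geodesic_path_concat_iff[OF _ _ that(1)] geodesic_exists that by metis+
  have "BRP_at G A \<phi> p \<longleftrightarrow> (\<exists>q\<ge>0. \<forall>u\<in>carrier G. \<forall>v\<in>carrier G.
     gprod u \<one> (u \<otimes> v) \<le> p / 2 \<longrightarrow> gprod (\<phi> u) \<one> (\<phi> (u \<otimes> v)) \<le> q / 2)"
    unfolding BRP_at_def using p
    by (intro ex_cong1 conj_cong refl ball_cong) (simp only: iff one_closed m_closed h.hom_closed)
  also have "\<dots> \<longleftrightarrow> (\<exists>q\<ge>0. \<forall>w\<in>carrier G. \<forall>x\<in>carrier G. \<forall>y\<in>carrier G.
    gprod w x y \<le> p / 2 \<longrightarrow> gprod (\<phi> w) (\<phi> x) (\<phi> y) \<le> q)" (is "?L \<longleftrightarrow> ?R")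
  proof
    assume ?L
    then obtain q where q: "q \<ge> 0" "\<And>u v. u \<in> carrier G \<Longrightarrow> v \<in> carrier G \<Longrightarrow>
       gprod u \<one> (u \<otimes> v) \<le> p / 2 \<Longrightarrow> gprod (\<phi> u) \<one> (\<phi> (u \<otimes> v)) \<le> q / 2" by blast
    have "gprod (\<phi> w) (\<phi> x) (\<phi> y) \<le> q / 2"
      if c: "w \<in> carrier G" "x \<in> carrier G" "y \<in> carrier G" and g: "gprod w x y \<le> p / 2" for w x y
    proof -
      \<comment> \<open>Left translation by \<open>x\<close> carries \<open>\<one>\<close>,
        \<open>?u\<close>, \<open>?u \<otimes> ?v\<close> to \<open>x\<close>, \<open>w\<close>,
        \<open>y\<close>; translation by \<open>\<phi> x\<close> does the same for the
        images.\<close>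
      let ?u = "inv x \<otimes> w" and ?v = "inv w \<otimes> y"
      have uv: "?u \<otimes> ?v = inv x \<otimes> y" "x \<otimes> ?u = w" "x \<otimes> (inv x \<otimes> y) = y"
        using c by (simp_all add: inv_solve_left' m_assoc) (metis c inv_closed inv_solve_left m_assoc m_closed)+
      have "gprod ?u \<one> (?u \<otimes> ?v) = gprod w x y"
        using gprod_translate[of x ?u \<one> "inv x \<otimes> y"] c uv by simp
      moreover have "gprod (\<phi> ?u) \<one> (\<phi> (?u \<otimes> ?v)) = gprod (\<phi> w) (\<phi> x) (\<phi> y)"
        using gprod_translate[of "\<phi> x" "\<phi> ?u" \<one> "\<phi> (inv x \<otimes> y)"] c uv
        by (metis h.hom_closed h.hom_mult inv_closed m_closed one_closed r_one)
      ultimately show ?thesis using q(2)[of ?u ?v] c g by simp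
    qed
    then show ?R using q(1) by (intro exI[of _ "q / 2"]) simp
  next
    assume ?R
    then obtain q where q: "q \<ge> 0" "\<And>w x y. w \<in> carrier G \<Longrightarrow> x \<in> carrier G \<Longrightarrow> y \<in> carrier G \<Longrightarrow>
       gprod w x y \<le> p / 2 \<Longrightarrow> gprod (\<phi> w) (\<phi> x) (\<phi> y) \<le> q" by blast
    have "gprod (\<phi> u) \<one> (\<phi> (u \<otimes> v)) \<le> 2 * q / 2"
      if "u \<in> carrier G" "v \<in> carrier G" "gprod u \<one> (u \<otimes> v) \<le> p / 2" for u v
      using q(2)[of u \<one> "u \<otimes> v"] that by simp
    then show ?L using q(1) by (intro exI[of _ "2 * q"]) simp
  qed
  finally show ?thesis .
qed

text \<open>A left translation moves the base point \<open>w\<close> to \<open>\<one>\<close>, and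
  the homomorphism property makes the images move along by a translation too.\<close>

lemma gromov_product_control_iff:
  assumes hom: "\<phi> \<in> hom G G"
  shows "(\<forall>u\<in>carrier G. \<forall>v\<in>carrier G.
      gromov_product G A u v \<le> p \<longrightarrow> gromov_product G A (\<phi> u) (\<phi> v) \<le> q) \<longleftrightarrow>
    (\<forall>w\<in>carrier G. \<forall>x\<in>carrier G. \<forall>y\<in>carrier G.
      gprod w x y \<le> p \<longrightarrow> gprod (\<phi> w) (\<phi> x) (\<phi> y) \<le> q)" (is "?L \<longleftrightarrow> ?R")
proof
  interpret h: group_hom G G \<phi> by unfold_locales (rule hom)
  {
    assume L: ?L
    show ?R
    proof (intro ballI impI)
      fix w x y assume c: "w \<in> carrier G" "x \<in> carrier G" "y \<in> carrier G" and g: "gprod w x y \<le> p"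
      let ?u = "inv w \<otimes> x" and ?v = "inv w \<otimes> y"
      have uv: "w \<otimes> ?u = x" "w \<otimes> ?v = y" using c by (simp_all flip: m_assoc)
      have "gromov_product G A ?u ?v = gprod w x y"
        using gprod_translate[of w \<one> ?u ?v] c uv by (simp add: gromov_product_eq_gprod)
      moreover have "gromov_product G A (\<phi> ?u) (\<phi> ?v) = gprod (\<phi> w) (\<phi> x) (\<phi> y)"
        using gprod_translate[of "\<phi> w" \<one> "\<phi> ?u" "\<phi> ?v"] c uv
        by (metis gromov_product_eq_gprod h.hom_closed h.hom_mult inv_closed m_closed one_closed r_one)
      ultimately show "gprod (\<phi> w) (\<phi> x) (\<phi> y) \<le> q"
        using L[rule_format, of ?u ?v] c g by simp
    qed
  next
    assume R: ?R
    show ?L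
    proof (intro ballI impI)
      fix u v assume c: "u \<in> carrier G" "v \<in> carrier G" and g: "gromov_product G A u v \<le> p"
      show "gromov_product G A (\<phi> u) (\<phi> v) \<le> q"
        using R[rule_format, of \<one> u v] c g by (simp add: gromov_product_eq_gprod)
    qed
  }
qed

end

section \<open>Lipschitz continuity of endomorphisms\<close>

lemma (in fg_group) hom_lipschitz:
  assumes fin: "finite A" and hom: "\<phi> \<in> hom G G"
  obtains L where "0 \<le> L"
    "\<And>x y. x \<in> carrier G \<Longrightarrow> y \<in> carrier G \<Longrightarrow> d (\<phi> x) (\<phi> y) \<le> L * d x y"
proof -
  interpret h: group_hom G G \<phi> by unfold_locales (rule hom)
  \<comment> \<open>The sum replaces a maximum: \<open>S\<close> is finite and the terms are
    nonnegative, so it bounds each of them, and no case distinction for empty \<open>S\<close>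
    arises.\<close>
  define L where "L = (\<Sum>s\<in>S. d \<one> (\<phi> s))"
  have L0: "0 \<le> L" unfolding L_def by (intro sum_nonneg d_ge0)
  have gen: "d \<one> (\<phi> s) \<le> L" if "s \<in> S" for s
    unfolding L_def using fin that by (intro member_le_sum) (auto simp: d_ge0)
  have word: "d \<one> (\<phi> (wprod ws)) \<le> L * length ws" if "set ws \<subseteq> S" for ws
    using that
  proof (induction ws)
    case Nil
    then show ?case by (simp add: d_refl)
  next
    case (Cons s ws)
    have c: "s \<in> carrier G" "wprod ws \<in> carrier G" using Cons.prems S_sub wprod_closed by auto
    have "d \<one> (\<phi> (wprod (s # ws))) \<le> d \<one> (\<phi> s) + d (\<phi> s) (\<phi> s \<otimes> \<phi> (wprod ws))"
      using c d_tri by simp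
    also have "d (\<phi> s) (\<phi> s \<otimes> \<phi> (wprod ws)) = d \<one> (\<phi> (wprod ws))"
      using d_translate[of "\<phi> s" \<one> "\<phi> (wprod ws)"] c by simp
    finally show ?case using Cons gen[of s] by (simp add: algebra_simps)
  qed
  have "d (\<phi> x) (\<phi> y) \<le> L * d x y" if c: "x \<in> carrier G" "y \<in> carrier G" for x y
  proof -
    obtain ws where ws: "set ws \<subseteq> S" "wprod ws = inv x \<otimes> y" "d x y = length ws"
      using d_word c by metis
    have "\<phi> y = \<phi> x \<otimes> \<phi> (inv x \<otimes> y)" using c by (simp flip: m_assoc)
    then have "d (\<phi> x) (\<phi> y) = d \<one> (\<phi> (inv x \<otimes> y))"
      using d_translate[of "\<phi> x" \<one> "\<phi> (inv x \<otimes> y)"] c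
      by (metis h.hom_closed inv_closed m_closed one_closed r_one)
    then show ?thesis using word[OF ws(1)] ws by simp
  qed
  then show ?thesis using that L0 by blast
qed

section \<open>Centers of triangles and Gromov products\<close>

locale coarse_median_group = fg_group +
  fixes K :: real and \<mu> :: "'a \<Rightarrow> 'a \<Rightarrow> 'a \<Rightarrow> 'a"
  assumes median: "coarse_median G A K \<mu>"
begin

lemma K_ge0: "0 \<le> K"
  using median by (simp add: coarse_median_def)

lemma median_closed:
  "x \<in> carrier G \<Longrightarrow> y \<in> carrier G \<Longrightarrow> z \<in> carrier G \<Longrightarrow> \<mu> x y z \<in> carrier G"
  using median by (simp add: coarse_median_def K_center_def)

lemma median_near_sides:
  assumes g: "geodesic G A x y l \<alpha>" "geodesic G A y z m \<beta>" "geodesic G A z x n \<gamma>"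
  shows "\<exists>i\<le>l. d (\<mu> x y z) (\<alpha> i) \<le> K" "\<exists>i\<le>m. d (\<mu> x y z) (\<beta> i) \<le> K"
    "\<exists>i\<le>n. d (\<mu> x y z) (\<gamma> i) \<le> K"
proof -
  have "K_center G A K x y z (\<mu> x y z)"
    using median geodesic_ends[OF g(1)] geodesic_ends[OF g(2)] by (simp add: coarse_median_def)
  then show "\<exists>i\<le>l. d (\<mu> x y z) (\<alpha> i) \<le> K" "\<exists>i\<le>m. d (\<mu> x y z) (\<beta> i) \<le> K"
    "\<exists>i\<le>n. d (\<mu> x y z) (\<gamma> i) \<le> K"
    using g unfolding K_center_def point_set_dist_path_le_iff by blast+
qed

text \<open>The center is within \<open>K\<close> of each side, so
  \<open>gprod_near_geodesic\<close> applies to all three.\<close>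

lemma gprod_median_le:
  assumes c: "x \<in> carrier G" "y \<in> carrier G" "z \<in> carrier G"
  shows "gprod (\<mu> x y z) x y \<le> K" "gprod (\<mu> x y z) y z \<le> K" "gprod (\<mu> x y z) z x \<le> K"
proof -
  obtain l \<alpha> where a: "geodesic G A x y l \<alpha>" using geodesic_exists c by metis
  obtain m \<beta> where b: "geodesic G A y z m \<beta>" using geodesic_exists c by metis
  obtain n \<gamma> where g: "geodesic G A z x n \<gamma>" using geodesic_exists c by metis
  note near = median_near_sides[OF a b g] and mc = median_closed[OF c]
  show "gprod (\<mu> x y z) x y \<le> K"
    using near(1) gprod_near_geodesic[OF a _ mc] by (meson order_trans)
  show "gprod (\<mu> x y z) y z \<le> K"
    using near(2) gprod_near_geodesic[OF b _ mc] by (meson order_trans)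
  show "gprod (\<mu> x y z) z x \<le> K"
    using near(3) gprod_near_geodesic[OF g _ mc] by (meson order_trans)
qed

text \<open>The center is within \<open>K\<close> of points \<open>\<beta> i\<close> and
  \<open>\<gamma> j\<close> on the two sides at \<open>w\<close>. Going from \<open>y\<close> to
  \<open>x\<close> via these points and the center shows that their distances from \<open>w\<close>
  add up to at most \<open>2 * gprod w x y + 2 * K\<close>. Averaging the bounds on
  \<open>d w (\<mu> x y w)\<close> via each of them gives the claim.\<close>

lemma d_median_le:
  assumes c: "x \<in> carrier G" "y \<in> carrier G" "w \<in> carrier G"
  shows "d w (\<mu> x y w) \<le> gprod w x y + 2 * K"
proof -
  obtain l \<alpha> where a: "geodesic G A x y l \<alpha>" using geodesic_exists c by metis
  obtain m \<beta> where b: "geodesic G A y w m \<beta>" using geodesic_exists c by metis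
  obtain n \<gamma> where g: "geodesic G A w x n \<gamma>" using geodesic_exists c by metis
  let ?c = "\<mu> x y w"
  note mc = median_closed[OF c]
  obtain i where i: "i \<le> m" "d ?c (\<beta> i) \<le> K" using median_near_sides(2)[OF a b g] by blast
  obtain j where j: "j \<le> n" "d ?c (\<gamma> j) \<le> K" using median_near_sides(3)[OF a b g] by blast
  have ic: "\<beta> i \<in> carrier G" "\<gamma> j \<in> carrier G" using xi_c[OF b] xi_c[OF g] i j by auto
  have "d y x \<le> d y (\<beta> i) + d (\<beta> i) ?c + (d ?c (\<gamma> j) + d (\<gamma> j) x)"
    using d_tri[of y "\<beta> i" ?c] d_tri[of ?c "\<gamma> j" x] d_tri[of y ?c x] c ic mc by simp
  moreover have "d w ?c \<le> d w (\<gamma> j) + d (\<gamma> j) ?c" "d w ?c \<le> d w (\<beta> i) + d (\<beta> i) ?c"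
    using d_tri c ic mc by simp_all
  moreover have "d w (\<beta> i) = d (\<beta> i) w" "d (\<beta> i) ?c = d ?c (\<beta> i)" "d (\<gamma> j) ?c = d ?c (\<gamma> j)"
    "d x w = d w x" "d w y = d y w" "d x y = d y x"
    using d_sym c ic mc by auto
  ultimately show ?thesis
    using geodesic_split[OF b i(1)] geodesic_split[OF g j(1)] geodesic_ends(5)[OF b]
      geodesic_ends(5)[OF g] i(2) j(2) unfolding gprod_def by argo
qed

text \<open>The route leads through the center of \<open>x\<close>, \<open>y\<close>,
  \<open>w\<close>, which is within \<open>K\<close> of every geodesic from \<open>x\<close> to
  \<open>y\<close>, hence of the given one.\<close>

lemma near_geodesic_of_gprod:
  assumes g: "geodesic G A x y n \<xi>" and w: "w \<in> carrier G"
  obtains i where "i \<le> n" "d w (\<xi> i) \<le> gprod w x y + 3 * K"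
proof -
  note c = geodesic_ends(1,2)[OF g] w
  obtain m \<beta> where b: "geodesic G A y w m \<beta>" using geodesic_exists c by metis
  obtain k \<gamma> where h: "geodesic G A w x k \<gamma>" using geodesic_exists c by metis
  obtain i where i: "i \<le> n" "d (\<mu> x y w) (\<xi> i) \<le> K" using median_near_sides(1)[OF g b h] by blast
  have "d w (\<xi> i) \<le> d w (\<mu> x y w) + d (\<mu> x y w) (\<xi> i)"
    using d_tri xi_c[OF g i(1)] median_closed[OF c] w by blast
  then show ?thesis using that[OF i(1)] i(2) d_median_le[OF c] by linarith
qed

text \<open>The distances from such a point to \<open>x\<close>, \<open>y\<close>, \<open>z\<close> are determined up to an error by the sides of
  the triangle, and so is the point, since it is close to \<open>[x,y]\<close>.\<close>

lemma center_unique: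
  assumes c: "x \<in> carrier G" "y \<in> carrier G" "z \<in> carrier G" "c \<in> carrier G" "c' \<in> carrier G"
    and q: "gprod c x y \<le> q" "gprod c y z \<le> q" "gprod c z x \<le> q"
    and q': "gprod c' x y \<le> q" "gprod c' y z \<le> q" "gprod c' z x \<le> q"
  shows "d c c' \<le> 7 * q + 12 * K"
proof -
  obtain n \<xi> where g: "geodesic G A x y n \<xi>" using geodesic_exists c by metis
  obtain i where i: "i \<le> n" "d c (\<xi> i) \<le> gprod c x y + 3 * K"
    using near_geodesic_of_gprod[OF g c(4)] .
  obtain j where j: "j \<le> n" "d c' (\<xi> j) \<le> gprod c' x y + 3 * K"
    using near_geodesic_of_gprod[OF g c(5)] .
  note ic = xi_c[OF g i(1)] xi_c[OF g j(1)]
  have dist: "d x e + d e y \<le> d x y + 2 * q" "d y e + d e z \<le> d y z + 2 * q"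
      "d z e + d e x \<le> d z x + 2 * q" "d x y \<le> d x e + d e y" "d y z \<le> d y e + d e z"
      "d z x \<le> d z e + d e x" "d e x = d x e" "d e y = d y e" "d e z = d z e"
    if "e \<in> carrier G" "gprod e x y \<le> q" "gprod e y z \<le> q" "gprod e z x \<le> q" for e
    using that c d_tri[of x e y] d_tri[of y e z] d_tri[of z e x] d_sym[of e x] d_sym[of e y] d_sym[of e z]
    by (auto simp: gprod_def)
  \<comment> \<open>For \<open>e\<close> either center, \<open>2 * d x e\<close> is the sum of the
    detours via \<open>e\<close> along the sides at \<open>x\<close> minus the detour along the side
    opposite \<open>x\<close>. Each is known up to \<open>2 * q\<close>, which leaves a range of
    length \<open>6 * q\<close>.\<close>
  have "\<bar>d x c - d x c'\<bar> \<le> 3 * q"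
    using dist[OF c(4) q] dist[OF c(5) q'] by linarith
  moreover have "\<bar>d x c - real i\<bar> \<le> d c (\<xi> i)" "\<bar>d x c' - real j\<bar> \<le> d c' (\<xi> j)"
    using d_tri[of x c "\<xi> i"] d_tri[of x "\<xi> i" c] d_sym[of c "\<xi> i"] geodesic_split(1)[OF g i(1)]
      d_tri[of x c' "\<xi> j"] d_tri[of x "\<xi> j" c'] d_sym[of c' "\<xi> j"] geodesic_split(1)[OF g j(1)]
      c ic by simp_all
  moreover have "d c c' \<le> d c (\<xi> i) + (d (\<xi> i) (\<xi> j) + d c' (\<xi> j))"
    using d_tri[of c "\<xi> i" c'] d_tri[of "\<xi> i" "\<xi> j" c'] d_sym[of c' "\<xi> j"] c ic by simp
  \<comment> \<open>The indices \<open>i\<close> and \<open>j\<close> differ by at most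
    \<open>3 * q + 2 * (q + 3 * K)\<close>; joining \<open>c\<close> and \<open>c'\<close> to the
    geodesic adds another \<open>2 * (q + 3 * K)\<close>.\<close>
  ultimately show ?thesis
    using xi_d[OF g i(1) j(1)] i(2) j(2) q(1) q'(1) by linarith
qed

end

section \<open>Endomorphisms and Gromov products: conditions (i) to (iv)\<close>

locale coarse_median_endo = coarse_median_group +
  fixes \<phi> :: "'a \<Rightarrow> 'a" and L :: real
  assumes hom: "\<phi> \<in> hom G G" and L_ge0: "0 \<le> L"
    and lipschitz: "\<And>x y. x \<in> carrier G \<Longrightarrow> y \<in> carrier G \<Longrightarrow> d (\<phi> x) (\<phi> y) \<le> L * d x y"
begin

text \<open>The statement \<open>M(p)\<close>.\<close>

definition gprod_control :: "real \<Rightarrow> bool" where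
  "gprod_control p \<longleftrightarrow> (\<exists>q\<ge>0. \<forall>w\<in>carrier G. \<forall>x\<in>carrier G. \<forall>y\<in>carrier G.
     gprod w x y \<le> p \<longrightarrow> gprod (\<phi> w) (\<phi> x) (\<phi> y) \<le> q)"

lemma hom_in: "x \<in> carrier G \<Longrightarrow> \<phi> x \<in> carrier G"
  using hom by (auto simp: hom_def)

lemma gprod_controlE:
  assumes "gprod_control p"
  obtains q where "0 \<le> q" "\<And>w x y. w \<in> carrier G \<Longrightarrow> x \<in> carrier G \<Longrightarrow> y \<in> carrier G \<Longrightarrow>
     gprod w x y \<le> p \<Longrightarrow> gprod (\<phi> w) (\<phi> x) (\<phi> y) \<le> q"
  using assms unfolding gprod_control_def by blast

lemma gprod_controlI:
  assumes "0 \<le> q" "\<And>w x y. w \<in> carrier G \<Longrightarrow> x \<in> carrier G \<Longrightarrow> y \<in> carrier G \<Longrightarrow>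
     gprod w x y \<le> p \<Longrightarrow> gprod (\<phi> w) (\<phi> x) (\<phi> y) \<le> q"
  shows "gprod_control p"
  using assms unfolding gprod_control_def by blast

lemma gprod_control_of_zero:
  assumes "gprod_control 0" "0 \<le> p" shows "gprod_control p"
proof -
  obtain q where q: "0 \<le> q" "\<And>w x y. w \<in> carrier G \<Longrightarrow> x \<in> carrier G \<Longrightarrow> y \<in> carrier G \<Longrightarrow>
     gprod w x y \<le> 0 \<Longrightarrow> gprod (\<phi> w) (\<phi> x) (\<phi> y) \<le> q" using gprod_controlE[OF assms(1)] by blast
  show ?thesis
  proof (rule gprod_controlI)
    \<comment> \<open>\<open>q\<close> bounds the product based at the image of a point of the
      geodesic within \<open>p + 3 * K\<close> of \<open>w\<close>; moving the base point to
      \<open>\<phi> w\<close> costs at most \<open>L\<close> times that distance.\<close>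
    show "0 \<le> q + L * (p + 3 * K)" using q(1) L_ge0 assms(2) K_ge0 by simp
    fix w x y assume c: "w \<in> carrier G" "x \<in> carrier G" "y \<in> carrier G" and g: "gprod w x y \<le> p"
    obtain n \<xi> where geo: "geodesic G A x y n \<xi>" using geodesic_exists c by metis
    obtain i where i: "i \<le> n" "d w (\<xi> i) \<le> gprod w x y + 3 * K"
      using near_geodesic_of_gprod[OF geo c(1)] .
    note ic = xi_c[OF geo i(1)]
    have "gprod (\<phi> w) (\<phi> x) (\<phi> y) \<le> gprod (\<phi> (\<xi> i)) (\<phi> x) (\<phi> y) + d (\<phi> w) (\<phi> (\<xi> i))"
      using gprod_base_le hom_in c ic by simp
    also have "gprod (\<phi> (\<xi> i)) (\<phi> x) (\<phi> y) \<le> q"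
      using q(2)[OF ic c(2,3)] gprod_on_geodesic[OF geo i(1)] by simp
    also have "d (\<phi> w) (\<phi> (\<xi> i)) \<le> L * d w (\<xi> i)" using lipschitz c ic by simp
    also have "L * d w (\<xi> i) \<le> L * (p + 3 * K)" using L_ge0 i(2) g by (intro mult_left_mono) auto
    finally show "gprod (\<phi> w) (\<phi> x) (\<phi> y) \<le> q + L * (p + 3 * K)" by simp
  qed
qed

lemma BRP_at_iff_gprod_control: "0 \<le> p \<Longrightarrow> BRP_at G A \<phi> p \<longleftrightarrow> gprod_control (p / 2)"
  using BRP_at_iff[OF _ hom] by (simp add: gprod_control_def)

lemma BRP_iff_gprod_control: "BRP G A \<phi> \<longleftrightarrow> gprod_control 0"
  using gprod_control_of_zero BRP_at_iff_gprod_control unfolding BRP_def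
  by (metis div_0 half_gt_zero_iff le_less order_refl)

text \<open>Conditions (iii) and (iv) ask for a positive bound; adding 1 to a nonnegative one
  provides it.\<close>

lemma ex_pos_gprod_bound_iff:
  "(\<exists>q::real. q > 0 \<and> (\<forall>w\<in>carrier G. \<forall>x\<in>carrier G. \<forall>y\<in>carrier G.
     gprod w x y \<le> p \<longrightarrow> gprod (\<phi> w) (\<phi> x) (\<phi> y) \<le> q)) \<longleftrightarrow> gprod_control p"
proof
  assume "gprod_control p"
  then obtain q where q: "0 \<le> q" "\<And>w x y. w \<in> carrier G \<Longrightarrow> x \<in> carrier G \<Longrightarrow> y \<in> carrier G \<Longrightarrow>
     gprod w x y \<le> p \<Longrightarrow> gprod (\<phi> w) (\<phi> x) (\<phi> y) \<le> q" by (rule gprod_controlE) blast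
  then show "\<exists>q::real. q > 0 \<and> (\<forall>w\<in>carrier G. \<forall>x\<in>carrier G. \<forall>y\<in>carrier G.
     gprod w x y \<le> p \<longrightarrow> gprod (\<phi> w) (\<phi> x) (\<phi> y) \<le> q)"
    by (intro exI[of _ "q + 1"] conjI ballI impI add_increasing2) auto
qed (auto simp: gprod_control_def intro: less_imp_le)

lemma gprod_control_antimono:
  assumes "gprod_control p" "p' \<le> p" shows "gprod_control p'"
  using assms unfolding gprod_control_def by (meson order_trans)

lemma gromov_product_control_pos_iff:
  "(\<forall>p::real. p > 0 \<longrightarrow> (\<exists>q::real. q > 0 \<and> (\<forall>u\<in>carrier G. \<forall>v\<in>carrier G.
      gromov_product G A u v \<le> p \<longrightarrow> gromov_product G A (\<phi> u) (\<phi> v) \<le> q))) \<longleftrightarrow> gprod_control 0"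
  unfolding gromov_product_control_iff[OF hom] ex_pos_gprod_bound_iff
  \<comment> \<open>Condition (iii) leaves out \<open>p = 0\<close>, which is recovered from
    \<open>p = 1\<close>.\<close>
  using gprod_control_of_zero gprod_control_antimono[of 1 0] by (metis le_less zero_less_one)

lemma gromov_product_control_zero_iff:
  "(\<exists>q::real. q > 0 \<and> (\<forall>u\<in>carrier G. \<forall>v\<in>carrier G.
      gromov_product G A u v = 0 \<longrightarrow> gromov_product G A (\<phi> u) (\<phi> v) \<le> q)) \<longleftrightarrow> gprod_control 0"
proof -
  have "gromov_product G A u v = 0 \<longleftrightarrow> gromov_product G A u v \<le> 0"
    if "u \<in> carrier G" "v \<in> carrier G" for u v
    using gprod_ge0[of \<one> u v] that by (auto simp: gromov_product_eq_gprod)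
  then have "(\<exists>q::real. q > 0 \<and> (\<forall>u\<in>carrier G. \<forall>v\<in>carrier G.
      gromov_product G A u v = 0 \<longrightarrow> gromov_product G A (\<phi> u) (\<phi> v) \<le> q)) \<longleftrightarrow>
    (\<exists>q::real. q > 0 \<and> (\<forall>u\<in>carrier G. \<forall>v\<in>carrier G.
      gromov_product G A u v \<le> 0 \<longrightarrow> gromov_product G A (\<phi> u) (\<phi> v) \<le> q))" by auto
  also have "\<dots> \<longleftrightarrow> gprod_control 0"
    unfolding gromov_product_control_iff[OF hom] ex_pos_gprod_bound_iff ..
  finally show ?thesis .
qed

section \<open>Images of geodesics: conditions (v) and (vi)\<close>

definition tracks :: "real \<Rightarrow> bool" where
  "tracks N \<longleftrightarrow> (\<forall>x y m \<alpha> n \<xi>. geodesic G A x y m \<alpha> \<and> geodesic G A (\<phi> x) (\<phi> y) n \<xi> \<longrightarrow>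
     (\<forall>i\<le>m. \<exists>j\<le>n. d (\<phi> (\<alpha> i)) (\<xi> j) \<le> N))"

text \<open>Points with vanishing product are exactly those on some geodesic from \<open>x\<close>
  to \<open>y\<close>, and a bounded product at \<open>\<phi> w\<close> means bounded distance from
  geodesics between the images.\<close>

lemma gprod_control_iff_tracks: "gprod_control 0 \<longleftrightarrow> (\<exists>N::nat. tracks (real N))"
proof
  assume "gprod_control 0"
  then obtain q where q: "0 \<le> q" "\<And>w x y. w \<in> carrier G \<Longrightarrow> x \<in> carrier G \<Longrightarrow> y \<in> carrier G \<Longrightarrow>
     gprod w x y \<le> 0 \<Longrightarrow> gprod (\<phi> w) (\<phi> x) (\<phi> y) \<le> q" by (rule gprod_controlE) blast
  obtain N :: nat where N: "q + 3 * K \<le> real N" using real_arch_simple by blast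
  have "tracks (real N)"
    unfolding tracks_def
  proof (intro allI impI, elim conjE)
    fix x y m \<alpha> n \<xi> i
    assume a: "geodesic G A x y m \<alpha>" and g: "geodesic G A (\<phi> x) (\<phi> y) n \<xi>" and i: "i \<le> m"
    note ic = xi_c[OF a i]
    obtain j where "j \<le> n" "d (\<phi> (\<alpha> i)) (\<xi> j) \<le> gprod (\<phi> (\<alpha> i)) (\<phi> x) (\<phi> y) + 3 * K"
      using near_geodesic_of_gprod[OF g hom_in[OF ic]] .
    moreover have "gprod (\<phi> (\<alpha> i)) (\<phi> x) (\<phi> y) \<le> q"
      using q(2)[OF ic geodesic_ends(1,2)[OF a]] gprod_on_geodesic[OF a i] by simp
    ultimately show "\<exists>j\<le>n. d (\<phi> (\<alpha> i)) (\<xi> j) \<le> real N" using N by (intro exI[of _ j]) simp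
  qed
  then show "\<exists>N::nat. tracks (real N)" ..
next
  assume "\<exists>N::nat. tracks (real N)"
  then obtain N :: nat where N: "tracks (real N)" ..
  show "gprod_control 0"
  proof (rule gprod_controlI)
    show "0 \<le> real N" by simp
    fix w x y assume c: "w \<in> carrier G" "x \<in> carrier G" "y \<in> carrier G" and "gprod w x y \<le> 0"
    then have "gprod w x y = 0" using gprod_ge0[of w x y] by simp
    then obtain m \<alpha> i where a: "geodesic G A x y m \<alpha>" and i: "i \<le> m" "\<alpha> i = w"
      using geodesic_through c by metis
    obtain n \<xi> where g: "geodesic G A (\<phi> x) (\<phi> y) n \<xi>" using geodesic_exists hom_in c by metis
    obtain j where j: "j \<le> n" "d (\<phi> w) (\<xi> j) \<le> real N"
      using N a g i unfolding tracks_def by metis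
    show "gprod (\<phi> w) (\<phi> x) (\<phi> y) \<le> real N"
      using gprod_near_geodesic[OF g j(1) hom_in[OF c(1)]] j(2) by simp
  qed
qed

lemma nbhd_iff_tracks:
  "(\<forall>x\<in>carrier G. \<forall>y\<in>carrier G. \<forall>m \<alpha>. geodesic G A x y m \<alpha> \<longrightarrow>
     (\<forall>n \<xi>. geodesic G A (\<phi> x) (\<phi> y) n \<xi> \<longrightarrow>
        \<phi> ` \<alpha> ` {..m} \<subseteq> nbhd (carrier G) d r (\<xi> ` {..n}))) \<longleftrightarrow> tracks r"
proof -
  have "\<phi> ` \<alpha> ` {..m} \<subseteq> nbhd (carrier G) d r (\<xi> ` {..n}) \<longleftrightarrow>
      (\<forall>i\<le>m. \<exists>j\<le>n. d (\<phi> (\<alpha> i)) (\<xi> j) \<le> r)"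
    if "geodesic G A x y m \<alpha>" for x y m \<alpha> n and \<xi> :: "nat \<Rightarrow> 'a"
    using path_subset_nbhd_iff[of m "\<phi> \<circ> \<alpha>" r \<xi> n] hom_in xi_c[OF that] by (simp add: image_comp)
  then show ?thesis unfolding tracks_def using geodesic_ends(1,2) by meson
qed

text \<open>As a point moves along the image of \<open>[x,y]\<close> in steps of length at most \<open>L\<close>, the points of \<open>\<xi>\<close>
  within \<open>N\<close> of it cannot jump over \<open>\<xi> k\<close> by more than \<open>2N + L\<close>.\<close>

lemma tracks_converse:
  assumes t: "tracks N" "0 \<le> N" and a: "geodesic G A x y m \<alpha>"
    and g: "geodesic G A (\<phi> x) (\<phi> y) n \<xi>" and k: "k \<le> n"
  shows "\<exists>i\<le>m. d (\<xi> k) (\<phi> (\<alpha> i)) \<le> 3 * N + L"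
proof -
  define P where "P i \<longleftrightarrow> (\<exists>j\<le>n. k \<le> j \<and> d (\<phi> (\<alpha> i)) (\<xi> j) \<le> N)" for i
  note ea = geodesic_ends[OF a] and eg = geodesic_ends[OF g]
  have "d (\<phi> (\<alpha> m)) (\<xi> n) = 0" using d_refl ea eg by simp
  then have Pm: "P m" unfolding P_def using t(2) k by auto
  \<comment> \<open>The first point of \<open>\<alpha>\<close> whose image is close to the part of
    \<open>\<xi>\<close> from index \<open>k\<close> on. The last point qualifies, as both paths end
    at \<open>\<phi> y\<close>.\<close>
  define i where "i = (LEAST i. P i)"
  have Pi: "P i" unfolding i_def using Pm by (rule LeastI)
  have im: "i \<le> m" unfolding i_def using Pm by (rule Least_le)
  obtain j where j: "j \<le> n" "k \<le> j" "d (\<phi> (\<alpha> i)) (\<xi> j) \<le> N" using Pi P_def by blast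
  show ?thesis
  proof (cases i)
    case 0
    \<comment> \<open>Here \<open>\<phi> (\<alpha> 0)\<close> is the start of \<open>\<xi>\<close>,
      so its distance from \<open>\<xi> j\<close> is \<open>j\<close>, and \<open>k\<close> is at
      most \<open>j\<close>.\<close>
    then have "real j \<le> N" using j geodesic_split(1)[OF g j(1)] ea by simp
    moreover have "d (\<xi> k) (\<phi> (\<alpha> 0)) = real k"
      using geodesic_split(1)[OF g k] d_sym xi_c[OF g k] eg(1) ea(3) by simp
    ultimately show ?thesis using j(2) t(2) L_ge0 by (intro exI[of _ 0]) simp
  next
    case (Suc i')
    then have "\<not> P i'" using not_less_Least[of i' P] by (simp add: i_def)
    moreover obtain j' where j': "j' \<le> n" "d (\<phi> (\<alpha> i')) (\<xi> j') \<le> N"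
      using t(1) a g im Suc unfolding tracks_def by (metis Suc_leD)
    ultimately have lt: "j' < k" unfolding P_def using not_le by blast
    have c: "\<alpha> i \<in> carrier G" "\<alpha> i' \<in> carrier G" using xi_c[OF a] im Suc by auto
    then have fc: "\<phi> (\<alpha> i) \<in> carrier G" "\<phi> (\<alpha> i') \<in> carrier G" using hom_in by auto
    have xc: "\<xi> j \<in> carrier G" "\<xi> j' \<in> carrier G" "\<xi> k \<in> carrier G" using xi_c[OF g] j j' k by auto
    have "d (\<alpha> i') (\<alpha> i) = 1" using xi_d[OF a, of i' i] im Suc by simp
    then have "d (\<phi> (\<alpha> i')) (\<phi> (\<alpha> i)) \<le> L" using lipschitz[OF c(2,1)] by simp
    then have "d (\<xi> j') (\<xi> j) \<le> 2 * N + L"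
      using d_tri[OF xc(2) fc(2) xc(1)] d_tri[OF fc(2) fc(1) xc(1)] d_sym[OF xc(2) fc(2)] j(3) j'(2)
      by linarith
    \<comment> \<open>Since \<open>k\<close> lies between \<open>j'\<close> and \<open>j\<close>, it
      is no farther from \<open>j'\<close> than \<open>j\<close> is.\<close>
    then have "d (\<xi> k) (\<xi> j') \<le> 2 * N + L"
      using xi_d[OF g j'(1) j(1)] xi_d[OF g k j'(1)] lt j(2) by simp
    then have "d (\<xi> k) (\<phi> (\<alpha> i')) \<le> 3 * N + L"
      using d_tri[OF xc(3,2) fc(2)] d_sym[OF xc(2) fc(2)] j'(2) by linarith
    then show ?thesis using im Suc by (intro exI[of _ i']) simp
  qed
qed

lemma hausdorff_iff_tracks:
  "(\<exists>N::nat. \<forall>x\<in>carrier G. \<forall>y\<in>carrier G. \<forall>m \<alpha> n \<xi>.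
     geodesic G A x y m \<alpha> \<and> geodesic G A (\<phi> x) (\<phi> y) n \<xi> \<longrightarrow>
     hausdorff_distance (carrier G) d (\<phi> ` \<alpha> ` {..m}) (\<xi> ` {..n}) \<le> real N) \<longleftrightarrow>
   (\<exists>N::nat. tracks (real N))" (is "?L \<longleftrightarrow> ?R")
proof
  assume ?L
  then obtain N :: nat where N: "\<And>x y m \<alpha> n \<xi>. geodesic G A x y m \<alpha> \<Longrightarrow>
      geodesic G A (\<phi> x) (\<phi> y) n \<xi> \<Longrightarrow>
      hausdorff_distance (carrier G) d (\<phi> ` \<alpha> ` {..m}) (\<xi> ` {..n}) \<le> real N"
    using geodesic_ends(1,2) by metis
  \<comment> \<open>The Hausdorff distance is an infimum of admissible radii; the extra 1 yields a
    radius strictly below the bound.\<close>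
  have "tracks (real (N + 1))"
    unfolding tracks_def
  proof (intro allI impI, elim conjE)
    fix x y m \<alpha> n \<xi> i
    assume a: "geodesic G A x y m \<alpha>" and g: "geodesic G A (\<phi> x) (\<phi> y) n \<xi>" and i: "i \<le> m"
    let ?R = "{r. 0 \<le> r \<and> (\<phi> \<circ> \<alpha>) ` {..m} \<subseteq> nbhd (carrier G) d r (\<xi> ` {..n}) \<and>
      \<xi> ` {..n} \<subseteq> nbhd (carrier G) d r ((\<phi> \<circ> \<alpha>) ` {..m})}"
    have ac: "(\<phi> \<circ> \<alpha>) i \<in> carrier G" if "i \<le> m" for i using hom_in xi_c[OF a that] by simp
    note xc = xi_c[OF g]
    \<comment> \<open>The infimum is informative only if some radius is admissible; the sum of all
      distances between the two finite paths is one.\<close>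
    define B where "B = (\<Sum>i\<le>m. \<Sum>j\<le>n. d ((\<phi> \<circ> \<alpha>) i) (\<xi> j))"
    have B: "d ((\<phi> \<circ> \<alpha>) i) (\<xi> j) \<le> B" if "i \<le> m" "j \<le> n" for i j
    proof -
      have "d ((\<phi> \<circ> \<alpha>) i) (\<xi> j) \<le> (\<Sum>j\<le>n. d ((\<phi> \<circ> \<alpha>) i) (\<xi> j))"
        using that by (intro member_le_sum) (auto simp: d_ge0)
      also have "\<dots> \<le> B" unfolding B_def
        using that by (intro member_le_sum) (auto intro: sum_nonneg d_ge0)
      finally show ?thesis .
    qed
    have "0 \<le> B" unfolding B_def by (intro sum_nonneg d_ge0)
    moreover have "(\<phi> \<circ> \<alpha>) ` {..m} \<subseteq> nbhd (carrier G) d B (\<xi> ` {..n})"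
      using path_subset_nbhd_iff[of m "\<phi> \<circ> \<alpha>", OF ac] B[of _ 0] by blast
    moreover have "\<xi> ` {..n} \<subseteq> nbhd (carrier G) d B ((\<phi> \<circ> \<alpha>) ` {..m})"
      using path_subset_nbhd_iff[of n \<xi>, OF xc] B[of 0] d_sym[OF ac[of 0] xc]
      by (metis le0)
    ultimately have "?R \<noteq> {}" by blast
    moreover have "Inf ?R < real (N + 1)"
      using N[OF a g] by (simp add: hausdorff_distance_def image_comp)
    ultimately obtain r where r: "r \<in> ?R" "r < real (N + 1)" using cInf_lessD by meson
    then obtain j where "j \<le> n" "d ((\<phi> \<circ> \<alpha>) i) (\<xi> j) \<le> r"
      using path_subset_nbhd_iff[of m "\<phi> \<circ> \<alpha>" r \<xi> n, OF ac] i by auto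
    then show "\<exists>j\<le>n. d (\<phi> (\<alpha> i)) (\<xi> j) \<le> real (N + 1)" using r(2) by (intro exI[of _ j]) simp
  qed
  then show ?R ..
next
  assume ?R
  then obtain N :: nat where N: "tracks (real N)" ..
  obtain M :: nat where M: "3 * real N + L \<le> real M" using real_arch_simple by blast
  have "hausdorff_distance (carrier G) d (\<phi> ` \<alpha> ` {..m}) (\<xi> ` {..n}) \<le> real M"
    if a: "geodesic G A x y m \<alpha>" and g: "geodesic G A (\<phi> x) (\<phi> y) n \<xi>" for x y m \<alpha> n \<xi>
  proof -
    have ac: "(\<phi> \<circ> \<alpha>) i \<in> carrier G" if "i \<le> m" for i using hom_in xi_c[OF a that] by simp
    have NM: "real N \<le> real M" using M L_ge0 by linarith
    have 1: "(\<phi> \<circ> \<alpha>) ` {..m} \<subseteq> nbhd (carrier G) d (real M) (\<xi> ` {..n})"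
      using path_subset_nbhd_iff[of m "\<phi> \<circ> \<alpha>" "real M" \<xi> n, OF ac] N a g NM
      unfolding tracks_def comp_def by (meson order_trans)
    have 2: "\<xi> ` {..n} \<subseteq> nbhd (carrier G) d (real M) ((\<phi> \<circ> \<alpha>) ` {..m})"
      using path_subset_nbhd_iff[of n \<xi> "real M" "\<phi> \<circ> \<alpha>" m, OF xi_c[OF g]]
        tracks_converse[OF N of_nat_0_le_iff a g] M unfolding comp_def by (meson order_trans)
    show ?thesis unfolding hausdorff_distance_def image_comp
      using 1 2 by (intro cInf_lower bdd_belowI[of _ 0]) auto
  qed
  then show ?L by blast
qed

section \<open>Preservation of coarse medians: condition (vii)\<close>

lemma median_preserving_iff: "coarse_median_preserving G A \<mu> \<phi> \<longleftrightarrow> gprod_control 0"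
proof
  assume "coarse_median_preserving G A \<mu> \<phi>"
  then obtain C where C: "0 \<le> C" "\<And>x y z. x \<in> carrier G \<Longrightarrow> y \<in> carrier G \<Longrightarrow> z \<in> carrier G \<Longrightarrow>
      d (\<phi> (\<mu> x y z)) (\<mu> (\<phi> x) (\<phi> y) (\<phi> z)) \<le> C"
    unfolding coarse_median_preserving_def by blast
  show "gprod_control 0"
  proof (rule gprod_controlI)
    \<comment> \<open>The product is at most \<open>K\<close> at the median of the images. From
      \<open>\<phi> w\<close> one gets there via \<open>\<phi> ?c\<close>, where \<open>?c\<close>
      is within \<open>2 * K\<close> of \<open>w\<close>; the two legs cost
      \<open>L * (2 * K)\<close> and \<open>C\<close>.\<close>
    show "0 \<le> K + (L * (2 * K) + C)" using K_ge0 L_ge0 C(1) by simp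
    fix w x y assume c: "w \<in> carrier G" "x \<in> carrier G" "y \<in> carrier G" and g: "gprod w x y \<le> 0"
    note f = hom_in[OF c(1)] hom_in[OF c(2)] hom_in[OF c(3)]
    let ?c = "\<mu> x y w" and ?c' = "\<mu> (\<phi> x) (\<phi> y) (\<phi> w)"
    have mc: "?c \<in> carrier G" "?c' \<in> carrier G" using median_closed c f by auto
    have "gprod (\<phi> w) (\<phi> x) (\<phi> y) \<le> gprod ?c' (\<phi> x) (\<phi> y) + d (\<phi> w) ?c'"
      using gprod_base_le f mc by blast
    also have "gprod ?c' (\<phi> x) (\<phi> y) \<le> K" using gprod_median_le(1) f by blast
    also have "d (\<phi> w) ?c' \<le> d (\<phi> w) (\<phi> ?c) + d (\<phi> ?c) ?c'" using d_tri f mc hom_in by blast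
    also have "d (\<phi> ?c) ?c' \<le> C" using C(2) c by blast
    also have "d (\<phi> w) (\<phi> ?c) \<le> L * d w ?c" using lipschitz c mc by blast
    also have "L * d w ?c \<le> L * (2 * K)"
      using d_median_le[OF c(2,3,1)] g L_ge0 by (intro mult_left_mono) auto
    finally show "gprod (\<phi> w) (\<phi> x) (\<phi> y) \<le> K + (L * (2 * K) + C)" by simp
  qed
next
  assume "gprod_control 0"
  then have "gprod_control K" using gprod_control_of_zero K_ge0 by blast
  then obtain q where q: "0 \<le> q" "\<And>w x y. w \<in> carrier G \<Longrightarrow> x \<in> carrier G \<Longrightarrow> y \<in> carrier G \<Longrightarrow>
     gprod w x y \<le> K \<Longrightarrow> gprod (\<phi> w) (\<phi> x) (\<phi> y) \<le> q" by (rule gprod_controlE) blast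
  \<comment> \<open>The products of the image triangle are at most \<open>q\<close> at the image of
    the median and at most \<open>K\<close> at the median of the images;
    \<open>center_unique\<close> is applied with the common bound \<open>q + K\<close>.\<close>
  have "d (\<phi> (\<mu> x y z)) (\<mu> (\<phi> x) (\<phi> y) (\<phi> z)) \<le> 7 * (q + K) + 12 * K"
    if c: "x \<in> carrier G" "y \<in> carrier G" "z \<in> carrier G" for x y z
  proof -
    note f = hom_in[OF c(1)] hom_in[OF c(2)] hom_in[OF c(3)] and mc = median_closed[OF c]
    note m = gprod_median_le[OF c] and m' = gprod_median_le[OF f]
    show ?thesis
      using q(2)[OF mc c(1,2) m(1)] q(2)[OF mc c(2,3) m(2)] q(2)[OF mc c(3,1) m(3)] m' q(1) K_ge0
      by (intro center_unique[OF f hom_in[OF mc] median_closed[OF f]]) auto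
  qed
  then show "coarse_median_preserving G A \<mu> \<phi>"
    unfolding coarse_median_preserving_def using q(1) K_ge0
    by (intro exI[of _ "7 * (q + K) + 12 * K"]) simp
qed

end

section \<open>Equivalence of the seven conditions through \<open>M(0)\<close>\<close>

theorem theorem4p8:
  fixes G :: "('a, 'b) monoid_scheme" and A :: "'a set" and \<phi> :: "'a \<Rightarrow> 'a"
    and K :: real and \<mu> :: "'a \<Rightarrow> 'a \<Rightarrow> 'a \<Rightarrow> 'a"
  assumes "group G"
    and "finite A" and "A \<subseteq> carrier G" and "generate G A = carrier G"
    and "hyperbolic_group G A"
    and "\<phi> \<in> hom G G"
    and "coarse_median G A K \<mu>"
  defines "cond1 \<equiv> BRP G A \<phi>"
    and "cond2 \<equiv> BRP_at G A \<phi> 0"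
    and "cond3 \<equiv> (\<forall>p::real. p > 0 \<longrightarrow> (\<exists>q::real. q > 0 \<and>
           (\<forall>u\<in>carrier G. \<forall>v\<in>carrier G.
              gromov_product G A u v \<le> p \<longrightarrow> gromov_product G A (\<phi> u) (\<phi> v) \<le> q)))"
    and "cond4 \<equiv> (\<exists>q::real. q > 0 \<and>
           (\<forall>u\<in>carrier G. \<forall>v\<in>carrier G.
              gromov_product G A u v = 0 \<longrightarrow> gromov_product G A (\<phi> u) (\<phi> v) \<le> q))"
    and "cond5 \<equiv> (\<exists>N::nat. \<forall>x\<in>carrier G. \<forall>y\<in>carrier G. \<forall>m \<alpha> n \<xi>.
           geodesic G A x y m \<alpha> \<and> geodesic G A (\<phi> x) (\<phi> y) n \<xi> \<longrightarrow>
           hausdorff_distance (carrier G) (word_dist G A) (\<phi> ` \<alpha> ` {..m}) (\<xi> ` {..n}) \<le> real N)"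
    and "cond6 \<equiv> (\<exists>N::nat. \<forall>x\<in>carrier G. \<forall>y\<in>carrier G. \<forall>m \<alpha>.
           geodesic G A x y m \<alpha> \<longrightarrow>
           (\<forall>n \<xi>. geodesic G A (\<phi> x) (\<phi> y) n \<xi> \<longrightarrow>
              \<phi> ` \<alpha> ` {..m} \<subseteq> nbhd (carrier G) (word_dist G A) (real N) (\<xi> ` {..n})))"
    and "cond7 \<equiv> coarse_median_preserving G A \<mu> \<phi>"
  shows "(cond1 \<longleftrightarrow> cond2) \<and> (cond1 \<longleftrightarrow> cond3) \<and> (cond1 \<longleftrightarrow> cond4) \<and>
         (cond1 \<longleftrightarrow> cond5) \<and> (cond1 \<longleftrightarrow> cond6) \<and> (cond1 \<longleftrightarrow> cond7)"
proof -
  interpret group G by fact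
  interpret fg_group G A by unfold_locales (use assms(3,4) in auto)
  obtain L where L: "0 \<le> L"
    "\<And>x y. x \<in> carrier G \<Longrightarrow> y \<in> carrier G \<Longrightarrow> word_dist G A (\<phi> x) (\<phi> y) \<le> L * word_dist G A x y"
    using hom_lipschitz[OF assms(2,6)] by blast
  interpret coarse_median_endo G A K \<mu> \<phi> L
    by unfold_locales (use assms(6,7) L in auto)
  have "cond1 \<longleftrightarrow> gprod_control 0" unfolding cond1_def by (rule BRP_iff_gprod_control)
  moreover have "cond2 \<longleftrightarrow> gprod_control 0" unfolding cond2_def using BRP_at_iff_gprod_control[of 0] by simp
  moreover have "cond3 \<longleftrightarrow> gprod_control 0" unfolding cond3_def by (rule gromov_product_control_pos_iff)
  moreover have "cond4 \<longleftrightarrow> gprod_control 0" unfolding cond4_def by (rule gromov_product_control_zero_iff)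
  moreover have "cond5 \<longleftrightarrow> gprod_control 0"
    unfolding cond5_def hausdorff_iff_tracks by (rule gprod_control_iff_tracks[symmetric])
  moreover have "cond6 \<longleftrightarrow> gprod_control 0"
    unfolding cond6_def nbhd_iff_tracks by (rule gprod_control_iff_tracks[symmetric])
  moreover have "cond7 \<longleftrightarrow> gprod_control 0" unfolding cond7_def by (rule median_preserving_iff)
  ultimately show ?thesis by simp
qed

end
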